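(* Let $L/K$ be a Galois field extension with finite Galois group $\Gamma$, let $(P,\Gamma,S)$ with $S=\{\Gamma_{xy}\mid x\le y \text{ in } P\}$ be a generalized equipped poset, let $A=(\mathrm{End}_K L)^{op}$, and let $\mathcal T=\{\mathcal T_{x,y}\}_{x\le y}$ be the family of subspaces of $A$ where $\mathcal T_{x,y}$ is the $L$-span of $\Gamma_{xy}$. Then the categories $\mathrm{Rep}(P,\Gamma,S)$ and $\mathrm{Rep}(P,A,\mathcal T)$ are equivalent.
   Context: A generalized equipped poset $(P,\Gamma,S)$ consists of a partially ordered set $P$, a finite group $\Gamma$ and non-empty subsets $\Gamma_{xy}\subseteq\Gamma$ for $x\le y$ in $P$ such that $\Gamma_{xy}\Gamma_{yz}\subseteq\Gamma_{xz}$ whenever $x\le y\le z$. Here $\Gamma$ is the Galois group of $L/K$. A space with $\Gamma$-action is an $L$-vector space $V$ with $K$-linear maps $s_\sigma:V\to V$ ($\sigma\in\Gamma$) such that $s_{\mathrm{id}}=\mathrm{id}_V$, $s_\tau s_\sigma=s_{\tau\sigma}$, and $s_\tau(va)=s_\tau(v)\tau(a)$ for $v\in V$, $a\in L$. $\mathrm{Rep}(P,\Gamma,S)$: objects are collections $(V;V_x: x\in P)$, where $V$ is an $L$-space with $\Gamma$-action, each $V_x$ is an $L$-subspace of $V$, and $x\le y$ implies $\sum_{\sigma\in\Gamma_{xy}}s_\sigma(V_x)\subseteq V_y$. A morphism $(V;V_x)\to(V';V'_x)$ is an $L$-linear map $\psi:V\to V'$ commuting with the $s_\sigma$, $s'_\sigma$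 for all $\sigma\in\Gamma$ and with $\psi(V_x)\subseteq V'_x$ for all $x$. The multiplication of $A=(\mathrm{End}_K L)^{op}$ is $h*h'=h'h$ (composition in reverse order). For $a\in L$, $\mu_a\in\mathrm{End}_KL$ is multiplication by $a$. For $x\le y$, $\mathcal T_{x,y}=\{\sum_{\sigma\in\Gamma_{xy}}\mu_{a_\sigma}\sigma \mid a_\sigma\in L\}\subseteq A$. $\mathrm{Rep}(P,A,\mathcal T)$: objects are collections $(V,V_x:x\in P)$, where $V$ is a right $A$-module and each $V_x$ is a $K$-subspace of $V$ with $V_x\mathcal T_{x,y}\subseteq V_y$ for all $x\le y$ (and $v1_x=v$ for $v\in V_x$, where $1_x$ is the unit of $\mathcal T_{x,x}$, namely the identity of $A$). A morphism $(V,V_x)\to(V',V'_x)$ is a right $A$-module morphism $h:V\to V'$ with $h(V_x)\subseteq V'_x$ for all $x$. *)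

theory Defs
  imports "HOL-Algebra.Finite_Extensions" "HOL-Algebra.Bij"
begin

section \<open>Categories and their equivalence\<close>

text \<open>
  Hom-sets of different pairs of objects need not be disjoint; composition therefore takes
  its three objects as arguments, and \<open>Comp C M N Q g f\<close> is $g \circ f$ for
  $f : M \to N$ and $g : N \to Q$.
\<close>

record ('o, 'm) cat =
  Obj :: "'o set"
  Hom :: "'o \<Rightarrow> 'o \<Rightarrow> 'm set"
  Comp :: "'o \<Rightarrow> 'o \<Rightarrow> 'o \<Rightarrow> 'm \<Rightarrow> 'm \<Rightarrow> 'm"
  Idm :: "'o \<Rightarrow> 'm"

locale category =
  fixes C :: "('o, 'm) cat"
  assumes comp_closed:
      "\<lbrakk>M \<in> Obj C; N \<in> Obj C; Q \<in> Obj C; f \<in> Hom C M N; g \<in> Hom C N Q\<rbrakk>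
        \<Longrightarrow> Comp C M N Q g f \<in> Hom C M Q"
    and comp_assoc:
      "\<lbrakk>J \<in> Obj C; M \<in> Obj C; N \<in> Obj C; Q \<in> Obj C;
        f \<in> Hom C J M; g \<in> Hom C M N; h \<in> Hom C N Q\<rbrakk>
        \<Longrightarrow> Comp C J N Q h (Comp C J M N g f) = Comp C J M Q (Comp C M N Q h g) f"
    and id_closed: "M \<in> Obj C \<Longrightarrow> Idm C M \<in> Hom C M M"
    and id_left:
      "\<lbrakk>M \<in> Obj C; N \<in> Obj C; f \<in> Hom C M N\<rbrakk> \<Longrightarrow> Comp C M N N (Idm C N) f = f"
    and id_right:
      "\<lbrakk>M \<in> Obj C; N \<in> Obj C; f \<in> Hom C M N\<rbrakk> \<Longrightarrow> Comp C M M N f (Idm C M) = f"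

locale covariant_functor =
  fixes C :: "('o1, 'm1) cat" and D :: "('o2, 'm2) cat"
    and F :: "'o1 \<Rightarrow> 'o2" and F1 :: "'o1 \<Rightarrow> 'o1 \<Rightarrow> 'm1 \<Rightarrow> 'm2"
  assumes obj_closed: "M \<in> Obj C \<Longrightarrow> F M \<in> Obj D"
    and hom_closed:
      "\<lbrakk>M \<in> Obj C; N \<in> Obj C; f \<in> Hom C M N\<rbrakk> \<Longrightarrow> F1 M N f \<in> Hom D (F M) (F N)"
    and preserves_comp:
      "\<lbrakk>M \<in> Obj C; N \<in> Obj C; Q \<in> Obj C; f \<in> Hom C M N; g \<in> Hom C N Q\<rbrakk>
        \<Longrightarrow> F1 M Q (Comp C M N Q g f) = Comp D (F M) (F N) (F Q) (F1 N Q g) (F1 M N f)"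
    and preserves_id: "M \<in> Obj C \<Longrightarrow> F1 M M (Idm C M) = Idm D (F M)"

definition iso_arrow :: "('o, 'm) cat \<Rightarrow> 'o \<Rightarrow> 'o \<Rightarrow> 'm \<Rightarrow> bool" where
  "iso_arrow C M N f \<longleftrightarrow> f \<in> Hom C M N \<and>
     (\<exists>g \<in> Hom C N M. Comp C M N M g f = Idm C M \<and> Comp C N M N f g = Idm C N)"

definition natural_iso ::
  "('o1, 'm1) cat \<Rightarrow> ('o2, 'm2) cat
    \<Rightarrow> ('o1 \<Rightarrow> 'o2) \<Rightarrow> ('o1 \<Rightarrow> 'o1 \<Rightarrow> 'm1 \<Rightarrow> 'm2)
    \<Rightarrow> ('o1 \<Rightarrow> 'o2) \<Rightarrow> ('o1 \<Rightarrow> 'o1 \<Rightarrow> 'm1 \<Rightarrow> 'm2)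
    \<Rightarrow> ('o1 \<Rightarrow> 'm2) \<Rightarrow> bool" where
  "natural_iso C D F F1 G G1 \<eta> \<longleftrightarrow>
     (\<forall>M \<in> Obj C. iso_arrow D (F M) (G M) (\<eta> M)) \<and>
     (\<forall>M \<in> Obj C. \<forall>N \<in> Obj C. \<forall>f \<in> Hom C M N.
        Comp D (F M) (F N) (G N) (\<eta> N) (F1 M N f)
        = Comp D (F M) (G M) (G N) (G1 M N f) (\<eta> M))"

definition equivalent_categories :: "('o1, 'm1) cat \<Rightarrow> ('o2, 'm2) cat \<Rightarrow> bool" where
  "equivalent_categories C D \<longleftrightarrow> category C \<and> category D \<and>
     (\<exists>F F1 G G1 \<eta> \<epsilon>.
        covariant_functor C D F F1 \<and> covariant_functor D C G G1 \<and>
        natural_iso C C (\<lambda>M. M) (\<lambda>M N f. f)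
          (\<lambda>M. G (F M)) (\<lambda>M N f. G1 (F M) (F N) (F1 M N f)) \<eta> \<and>
        natural_iso D D (\<lambda>M. F (G M)) (\<lambda>M N f. F1 (G M) (G N) (G1 M N f))
          (\<lambda>M. M) (\<lambda>M N f. f) \<epsilon>)"


section \<open>Galois extensions\<close>

text \<open>The product in the Galois group is composition of maps: $\sigma\tau = \sigma \circ \tau$.\<close>

definition galois_group :: "('a, 'b) ring_scheme \<Rightarrow> 'a set \<Rightarrow> ('a \<Rightarrow> 'a) monoid" where
  "galois_group L K = (BijGroup (carrier L))
     \<lparr>carrier := {\<sigma> \<in> Bij (carrier L). \<sigma> \<in> ring_hom L L \<and> (\<forall>k \<in> K. \<sigma> k = k)}\<rparr>"

locale galois_extension = field L for L (structure) and K +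
  assumes base_subfield: "subfield K L"
    and algebraic_extension: "x \<in> carrier L \<Longrightarrow> (algebraic over K) x"
    and fixed_field: "{x \<in> carrier L. \<forall>\<sigma> \<in> carrier (galois_group L K). \<sigma> x = x} = K"


section \<open>Generalized equipped posets\<close>

locale generalized_equipped_poset = P: partial_order P + G: group G
  for P :: "('p, 'q) gorder_scheme" and G :: "('g, 'h) monoid_scheme"
    and S :: "'p \<Rightarrow> 'p \<Rightarrow> 'g set" +
  assumes finite_group: "finite (carrier G)"
    and S_subset: "\<lbrakk>x \<in> carrier P; y \<in> carrier P; x \<sqsubseteq>\<^bsub>P\<^esub> y\<rbrakk> \<Longrightarrow> S x y \<subseteq> carrier G"
    and S_nonempty: "\<lbrakk>x \<in> carrier P; y \<in> carrier P; x \<sqsubseteq>\<^bsub>P\<^esub> y\<rbrakk> \<Longrightarrow> S x y \<noteq> {}"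
    and S_mult:
      "\<lbrakk>x \<in> carrier P; y \<in> carrier P; z \<in> carrier P; x \<sqsubseteq>\<^bsub>P\<^esub> y; y \<sqsubseteq>\<^bsub>P\<^esub> z\<rbrakk>
        \<Longrightarrow> S x y <#>\<^bsub>G\<^esub> S y z \<subseteq> S x z"


section \<open>Representations with a Galois action\<close>

text \<open>
  The scalar product $va$ of the vector $v$ with $a \in L$ is written \<open>a \<odot>\<^bsub>V\<^esub> v\<close>;
  the side is immaterial as $L$ is commutative. Underlying sets of objects are subsets of
  the type \<open>'v\<close>, which acts as the universe of the category. Objects whose operations
  differ only outside the carrier are distinct but isomorphic.
\<close>

locale galois_space = module L V
  for L :: "('a, 'b) ring_scheme" (structure) and K :: "'a set"
    and V :: "('a, 'v) module" and s :: "('a \<Rightarrow> 'a) \<Rightarrow> 'v \<Rightarrow> 'v" +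
  assumes act_closed:
      "\<lbrakk>\<sigma> \<in> carrier (galois_group L K); v \<in> carrier V\<rbrakk> \<Longrightarrow> s \<sigma> v \<in> carrier V"
    and act_add:
      "\<lbrakk>\<sigma> \<in> carrier (galois_group L K); v \<in> carrier V; w \<in> carrier V\<rbrakk>
        \<Longrightarrow> s \<sigma> (v \<oplus>\<^bsub>V\<^esub> w) = s \<sigma> v \<oplus>\<^bsub>V\<^esub> s \<sigma> w"
    and act_base_smult:
      "\<lbrakk>\<sigma> \<in> carrier (galois_group L K); v \<in> carrier V; k \<in> K\<rbrakk>
        \<Longrightarrow> s \<sigma> (k \<odot>\<^bsub>V\<^esub> v) = k \<odot>\<^bsub>V\<^esub> s \<sigma> v"
    and act_id: "v \<in> carrier V \<Longrightarrow> s \<one>\<^bsub>galois_group L K\<^esub> v = v"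
    and act_mult:
      "\<lbrakk>\<sigma> \<in> carrier (galois_group L K); \<tau> \<in> carrier (galois_group L K); v \<in> carrier V\<rbrakk>
        \<Longrightarrow> s \<tau> (s \<sigma> v) = s (\<tau> \<otimes>\<^bsub>galois_group L K\<^esub> \<sigma>) v"
    and act_semilinear:
      "\<lbrakk>\<tau> \<in> carrier (galois_group L K); v \<in> carrier V; a \<in> carrier L\<rbrakk>
        \<Longrightarrow> s \<tau> (a \<odot>\<^bsub>V\<^esub> v) = \<tau> a \<odot>\<^bsub>V\<^esub> s \<tau> v"

record ('a, 'v, 'p) grep =
  gspace :: "('a, 'v) module"
  gact :: "('a \<Rightarrow> 'a) \<Rightarrow> 'v \<Rightarrow> 'v"
  gsub :: "'p \<Rightarrow> 'v set"

definition is_grep ::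
  "('a, 'b) ring_scheme \<Rightarrow> 'a set \<Rightarrow> ('p, 'q) gorder_scheme
    \<Rightarrow> ('p \<Rightarrow> 'p \<Rightarrow> ('a \<Rightarrow> 'a) set) \<Rightarrow> ('a, 'v, 'p) grep \<Rightarrow> bool" where
  "is_grep L K P S M \<longleftrightarrow>
     galois_space L K (gspace M) (gact M) \<and>
     (\<forall>x \<in> carrier P. submodule (gsub M x) L (gspace M)) \<and>
     (\<forall>x \<in> carrier P. \<forall>y \<in> carrier P. x \<sqsubseteq>\<^bsub>P\<^esub> y \<longrightarrow>
        {\<Oplus>\<^bsub>gspace M\<^esub>\<sigma> \<in> S x y. gact M \<sigma> (v \<sigma>) | v. v \<in> S x y \<rightarrow> gsub M x} \<subseteq> gsub M y)"

text \<open>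
  Morphisms are extensional functions, so that equality of morphisms is equality on the
  carrier.
\<close>

definition grep_hom ::
  "('a, 'b) ring_scheme \<Rightarrow> 'a set \<Rightarrow> ('p, 'q) gorder_scheme
    \<Rightarrow> ('a, 'v, 'p) grep \<Rightarrow> ('a, 'v, 'p) grep \<Rightarrow> ('v \<Rightarrow> 'v) set" where
  "grep_hom L K P M N =
     {\<psi> \<in> carrier (gspace M) \<rightarrow>\<^sub>E carrier (gspace N).
        (\<forall>v \<in> carrier (gspace M). \<forall>w \<in> carrier (gspace M).
           \<psi> (v \<oplus>\<^bsub>gspace M\<^esub> w) = \<psi> v \<oplus>\<^bsub>gspace N\<^esub> \<psi> w) \<and>
        (\<forall>a \<in> carrier L. \<forall>v \<in> carrier (gspace M).
           \<psi> (a \<odot>\<^bsub>gspace M\<^esub> v) = a \<odot>\<^bsub>gspace N\<^esub> \<psi> v) \<and>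
        (\<forall>\<sigma> \<in> carrier (galois_group L K). \<forall>v \<in> carrier (gspace M).
           \<psi> (gact M \<sigma> v) = gact N \<sigma> (\<psi> v)) \<and>
        (\<forall>x \<in> carrier P. \<psi> ` gsub M x \<subseteq> gsub N x)}"

definition Rep_Gamma ::
  "('a, 'b) ring_scheme \<Rightarrow> 'a set \<Rightarrow> ('p, 'q) gorder_scheme
    \<Rightarrow> ('p \<Rightarrow> 'p \<Rightarrow> ('a \<Rightarrow> 'a) set) \<Rightarrow> (('a, 'v, 'p) grep, 'v \<Rightarrow> 'v) cat" where
  "Rep_Gamma L K P S =
     \<lparr>Obj = {M. is_grep L K P S M},
      Hom = grep_hom L K P,
      Comp = \<lambda>M N Q g f. compose (carrier (gspace M)) g f,
      Idm = \<lambda>M. \<lambda>v \<in> carrier (gspace M). v\<rparr>"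


section \<open>Endomorphism rings\<close>

text \<open>The ring of $K$-linear endomorphisms of $L$, with composition as multiplication.\<close>

definition End_K :: "('a, 'b) ring_scheme \<Rightarrow> 'a set \<Rightarrow> ('a \<Rightarrow> 'a) ring" where
  "End_K L K =
     \<lparr>carrier = {h \<in> carrier L \<rightarrow>\<^sub>E carrier L.
        (\<forall>a \<in> carrier L. \<forall>b \<in> carrier L. h (a \<oplus>\<^bsub>L\<^esub> b) = h a \<oplus>\<^bsub>L\<^esub> h b) \<and>
        (\<forall>k \<in> K. \<forall>a \<in> carrier L. h (k \<otimes>\<^bsub>L\<^esub> a) = k \<otimes>\<^bsub>L\<^esub> h a)},
      mult = \<lambda>h h'. compose (carrier L) h h',
      one = \<lambda>a \<in> carrier L. a,
      zero = \<lambda>a \<in> carrier L. \<zero>\<^bsub>L\<^esub>,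
      add = \<lambda>h h'. \<lambda>a \<in> carrier L. h a \<oplus>\<^bsub>L\<^esub> h' a\<rparr>"

definition opposite_ring :: "('a, 'b) ring_scheme \<Rightarrow> ('a, 'b) ring_scheme" where
  "opposite_ring R = R\<lparr>mult := \<lambda>x y. y \<otimes>\<^bsub>R\<^esub> x\<rparr>"

definition mult_map :: "('a, 'b) ring_scheme \<Rightarrow> 'a \<Rightarrow> 'a \<Rightarrow> 'a" where
  "mult_map L a = (\<lambda>b \<in> carrier L. a \<otimes>\<^bsub>L\<^esub> b)"

text \<open>In $\mu_a\sigma$ the product is composition of maps, not the reversed product.\<close>

definition L_span :: "('a, 'b) ring_scheme \<Rightarrow> 'a set \<Rightarrow> ('a \<Rightarrow> 'a) set \<Rightarrow> ('a \<Rightarrow> 'a) set" where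
  "L_span L K M =
     {\<Oplus>\<^bsub>opposite_ring (End_K L K)\<^esub>\<sigma> \<in> M. compose (carrier L) (mult_map L (a \<sigma>)) \<sigma>
        | a. a \<in> M \<rightarrow> carrier L}"


section \<open>Representations over an algebra\<close>

record ('r, 'v) rmodule = "'v ring" +
  ract :: "'v \<Rightarrow> 'r \<Rightarrow> 'v" (infixl \<open>\<star>\<index>\<close> 70)

locale right_module = A?: ring A + V?: abelian_group V
  for A :: "('r, 'c) ring_scheme" (structure) and V :: "('r, 'v) rmodule" (structure) +
  assumes ract_closed: "\<lbrakk>v \<in> carrier V; h \<in> carrier A\<rbrakk> \<Longrightarrow> v \<star>\<^bsub>V\<^esub> h \<in> carrier V"
    and ract_add_left:
      "\<lbrakk>v \<in> carrier V; w \<in> carrier V; h \<in> carrier A\<rbrakk>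
        \<Longrightarrow> (v \<oplus>\<^bsub>V\<^esub> w) \<star>\<^bsub>V\<^esub> h = v \<star>\<^bsub>V\<^esub> h \<oplus>\<^bsub>V\<^esub> w \<star>\<^bsub>V\<^esub> h"
    and ract_add_right:
      "\<lbrakk>v \<in> carrier V; h \<in> carrier A; h' \<in> carrier A\<rbrakk>
        \<Longrightarrow> v \<star>\<^bsub>V\<^esub> (h \<oplus>\<^bsub>A\<^esub> h') = v \<star>\<^bsub>V\<^esub> h \<oplus>\<^bsub>V\<^esub> v \<star>\<^bsub>V\<^esub> h'"
    and ract_mult:
      "\<lbrakk>v \<in> carrier V; h \<in> carrier A; h' \<in> carrier A\<rbrakk>
        \<Longrightarrow> v \<star>\<^bsub>V\<^esub> (h \<otimes>\<^bsub>A\<^esub> h') = (v \<star>\<^bsub>V\<^esub> h) \<star>\<^bsub>V\<^esub> h'"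
    and ract_one: "v \<in> carrier V \<Longrightarrow> v \<star>\<^bsub>V\<^esub> \<one>\<^bsub>A\<^esub> = v"

record ('r, 'v, 'p) arep =
  aspace :: "('r, 'v) rmodule"
  asub :: "'p \<Rightarrow> 'v set"

text \<open>
  The map \<open>\<iota>\<close> is the structure map $K \to A$ of the $K$-algebra $A$; through it every right
  $A$-module is a $K$-vector space. For $A = (\mathrm{End}_K L)^{op}$ it sends $k$ to
  multiplication by $k$.
\<close>

definition is_arep ::
  "'k set \<Rightarrow> ('k \<Rightarrow> 'r) \<Rightarrow> ('p, 'q) gorder_scheme \<Rightarrow> ('r, 'c) ring_scheme
    \<Rightarrow> ('p \<Rightarrow> 'p \<Rightarrow> 'r set) \<Rightarrow> ('r, 'v, 'p) arep \<Rightarrow> bool" where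
  "is_arep K \<iota> P A T M \<longleftrightarrow>
     right_module A (aspace M) \<and>
     (\<forall>x \<in> carrier P.
        subgroup (asub M x) (add_monoid (aspace M)) \<and>
        (\<forall>k \<in> K. \<forall>v \<in> asub M x. v \<star>\<^bsub>aspace M\<^esub> \<iota> k \<in> asub M x)) \<and>
     (\<forall>x \<in> carrier P. \<forall>y \<in> carrier P. x \<sqsubseteq>\<^bsub>P\<^esub> y \<longrightarrow>
        (\<forall>v \<in> asub M x. \<forall>t \<in> T x y. v \<star>\<^bsub>aspace M\<^esub> t \<in> asub M y)) \<and>
     (\<forall>x \<in> carrier P. \<forall>v \<in> asub M x. v \<star>\<^bsub>aspace M\<^esub> \<one>\<^bsub>A\<^esub> = v)"

definition arep_hom ::
  "('p, 'q) gorder_scheme \<Rightarrow> ('r, 'c) ring_scheme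
    \<Rightarrow> ('r, 'v, 'p) arep \<Rightarrow> ('r, 'v, 'p) arep \<Rightarrow> ('v \<Rightarrow> 'v) set" where
  "arep_hom P A M N =
     {\<psi> \<in> carrier (aspace M) \<rightarrow>\<^sub>E carrier (aspace N).
        (\<forall>v \<in> carrier (aspace M). \<forall>w \<in> carrier (aspace M).
           \<psi> (v \<oplus>\<^bsub>aspace M\<^esub> w) = \<psi> v \<oplus>\<^bsub>aspace N\<^esub> \<psi> w) \<and>
        (\<forall>v \<in> carrier (aspace M). \<forall>h \<in> carrier A.
           \<psi> (v \<star>\<^bsub>aspace M\<^esub> h) = \<psi> v \<star>\<^bsub>aspace N\<^esub> h) \<and>
        (\<forall>x \<in> carrier P. \<psi> ` asub M x \<subseteq> asub N x)}"

definition Rep_alg ::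
  "'k set \<Rightarrow> ('k \<Rightarrow> 'r) \<Rightarrow> ('p, 'q) gorder_scheme \<Rightarrow> ('r, 'c) ring_scheme
    \<Rightarrow> ('p \<Rightarrow> 'p \<Rightarrow> 'r set) \<Rightarrow> (('r, 'v, 'p) arep, 'v \<Rightarrow> 'v) cat" where
  "Rep_alg K \<iota> P A T =
     \<lparr>Obj = {M. is_arep K \<iota> P A T M},
      Hom = arep_hom P A,
      Comp = \<lambda>M N Q g f. compose (carrier (aspace M)) g f,
      Idm = \<lambda>M. \<lambda>v \<in> carrier (aspace M). v\<rparr>"

end

theory Submission
  imports Defs
begin

text \<open>
  Choose $x_i, y_i \in L$ with $\sum_i x_i\,\sigma(y_i) = \delta_{\sigma,1}$ for all
  $\sigma \in \Gamma$. With $T(v) = \sum_\sigma s_\sigma(v)$ one has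
  $b = \sum_i x_i\,\mathrm{tr}(y_i b)$ on $L$ and $v = \sum_i x_i\,T(y_i v)$ on every space with
  $\Gamma$-action. Hence $v \cdot h = \sum_i h(x_i)\,T(y_i v)$ extends the action of $L$ and
  $\Gamma$ to an action of $\mathrm{End}_K L$, and every $A$-module arises this way. Neither
  independence of characters nor $[L:K] = |\Gamma|$ is needed. On subspaces, $V_x$ is stable
  under $L$ because $\Gamma_{xx}$ contains the identity.
\<close>

text \<open>The x_i need not be independent over K, so a map cannot be prescribed by free values on
  them, and the action of A is not built on a basis. It is given outright by a formula with the
  values h(x_i) as coefficients. The formula is forced: the maps b \<mapsto> tr(y_i b) are
  coordinate functionals for the x_i, so every h in A is a sum of products of \<mu>_{y_i}, the sum
  of all \<sigma>, and \<mu>_{h(x_i)}, in this order, the left factor acting first. The price is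
  that the module law is not visible in the formula. It holds because traces lie in K, so that
  endomorphisms carry them through. The coordinates come from treating one \<sigma> at a time: if
  \<sigma> moves c, then \<sigma>(c) - c is invertible in the field L. Neither construction touches
  vectors or maps. Going there and back reproduces the operations only on the carrier, so the two
  constructions are inverse up to identity maps and not as equalities of objects.\<close>

section \<open>Additive maps, finite sums and change of record type\<close>

lemma additive_zero:
  assumes "abelian_group M" "abelian_group N" "f \<in> carrier M \<rightarrow> carrier N"
    and "\<And>v w. \<lbrakk>v \<in> carrier M; w \<in> carrier M\<rbrakk> \<Longrightarrow> f (v \<oplus>\<^bsub>M\<^esub> w) = f v \<oplus>\<^bsub>N\<^esub> f w"
  shows "f \<zero>\<^bsub>M\<^esub> = \<zero>\<^bsub>N\<^esub>"
proof -
  interpret M: abelian_group M by fact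
  interpret N: abelian_group N by fact
  have "f \<zero>\<^bsub>M\<^esub> \<oplus>\<^bsub>N\<^esub> f \<zero>\<^bsub>M\<^esub> = f \<zero>\<^bsub>M\<^esub>"
    using assms(4)[of "\<zero>\<^bsub>M\<^esub>" "\<zero>\<^bsub>M\<^esub>"] by simp
  moreover have "f \<zero>\<^bsub>M\<^esub> \<in> carrier N"
    using assms(3) by auto
  ultimately show ?thesis
    by simp
qed

lemma additive_finsum:
  assumes "abelian_group M" "abelian_group N" "f \<in> carrier M \<rightarrow> carrier N"
    and add: "\<And>v w. \<lbrakk>v \<in> carrier M; w \<in> carrier M\<rbrakk> \<Longrightarrow> f (v \<oplus>\<^bsub>M\<^esub> w) = f v \<oplus>\<^bsub>N\<^esub> f w"
    and "finite I" "g \<in> I \<rightarrow> carrier M"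
  shows "f (\<Oplus>\<^bsub>M\<^esub>i\<in>I. g i) = (\<Oplus>\<^bsub>N\<^esub>i\<in>I. f (g i))"
proof -
  interpret M: abelian_group M by fact
  interpret N: abelian_group N by fact
  show ?thesis
    using \<open>finite I\<close> assms(6)
  proof (induction I)
    case empty
    then show ?case
      using additive_zero[OF assms(1-3) add] by simp
  next
    case (insert i I)
    have "f (g j) \<in> carrier N" if "j \<in> insert i I" for j
      using assms(3) insert.prems that by blast
    then show ?case
      using insert by (simp add: M.finsum_insert N.finsum_insert Pi_iff add)
  qed
qed

lemma (in abelian_group) finsum_swap:
  assumes "finite I" "finite J" "\<And>i j. \<lbrakk>i \<in> I; j \<in> J\<rbrakk> \<Longrightarrow> g i j \<in> carrier G"
  shows "(\<Oplus>i\<in>I. \<Oplus>j\<in>J. g i j) = (\<Oplus>j\<in>J. \<Oplus>i\<in>I. g i j)"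
  using assms(1,3)
proof (induction I)
  case empty
  then show ?case by (simp add: finsum_zero)
next
  case (insert i I)
  have "(\<Oplus>j\<in>J. \<Oplus>k\<in>insert i I. g k j) = (\<Oplus>j\<in>J. g i j \<oplus> (\<Oplus>k\<in>I. g k j))"
    using insert by (intro finsum_cong') (auto simp: finsum_insert Pi_iff intro!: a_closed finsum_closed)
  also have "\<dots> = (\<Oplus>j\<in>J. g i j) \<oplus> (\<Oplus>j\<in>J. \<Oplus>k\<in>I. g k j)"
    using insert by (intro finsum_addf) (auto intro!: finsum_closed)
  also have "\<dots> = (\<Oplus>k\<in>insert i I. \<Oplus>j\<in>J. g k j)"
    using insert by (subst finsum_insert) (auto intro!: finsum_closed)
  finally show ?case by simp
qed

lemma (in abelian_group) finsum_delta:
  assumes "finite I" "i \<in> I" "v \<in> carrier G"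
  shows "(\<Oplus>j\<in>I. if j = i then v else \<zero>) = v"
  using finsum_singleton[of i I "\<lambda>_. v"] assms by (simp add: eq_commute)

lemma subgroup_finsum_closed:
  assumes "abelian_group M" "subgroup H (add_monoid M)" "finite I" "\<And>i. i \<in> I \<Longrightarrow> g i \<in> H"
  shows "(\<Oplus>\<^bsub>M\<^esub>i\<in>I. g i) \<in> H"
proof -
  interpret M: abelian_group M by fact
  interpret H: subgroup H "add_monoid M" by fact
  show ?thesis
    using assms(3,4)
  proof (induction I)
    case empty
    then show ?case using H.one_closed by simp
  next
    case (insert i I)
    have "g j \<in> carrier M" if "j \<in> insert i I" for j
      using insert.prems[OF that] H.subset by auto
    then show ?case
      using insert H.m_closed by (simp add: M.finsum_insert Pi_iff)
  qed
qed

text \<open>The axioms see only carrier, addition and zero. This moves them between modules over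
  \<open>L\<close> and right modules over \<open>A\<close>, which are records of different types
  with the same additive group.\<close>

lemma abelian_group_cong:
  assumes "abelian_group M" "carrier N = carrier M" "add N = add M" "\<zero>\<^bsub>N\<^esub> = \<zero>\<^bsub>M\<^esub>"
  shows "abelian_group N"
  using abelian_groupE[OF assms(1)] by (intro abelian_groupI) (simp_all add: assms(2-4))

text \<open>Restriction of scalars along a \<mapsto> \<mu>_a. This map respects the reversed product
  of the endomorphism ring because \<open>L\<close> is commutative.\<close>

definition of_rmodule :: "('a, 'b) ring_scheme \<Rightarrow> ('a \<Rightarrow> 'a, 'v) rmodule \<Rightarrow> ('a, 'v) module" where
  "of_rmodule L W = \<lparr>carrier = carrier W, mult = mult W, one = \<one>\<^bsub>W\<^esub>, zero = \<zero>\<^bsub>W\<^esub>,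
     add = add W, smult = \<lambda>a v. v \<star>\<^bsub>W\<^esub> mult_map L a\<rparr>"

lemma of_rmodule_sel [simp]:
  "carrier (of_rmodule L W) = carrier W" "add (of_rmodule L W) = add W"
  "\<zero>\<^bsub>of_rmodule L W\<^esub> = \<zero>\<^bsub>W\<^esub>" "a \<odot>\<^bsub>of_rmodule L W\<^esub> v = v \<star>\<^bsub>W\<^esub> mult_map L a"
  by (simp_all add: of_rmodule_def)

lemma finsum_of_rmodule: "finsum (of_rmodule L W) = finsum W"
  by (simp add: finsum_def finprod_def fun_eq_iff)

lemma subgroup_add_cong:
  assumes "subgroup H (add_monoid M)" "carrier N = carrier M" "add N = add M" "\<zero>\<^bsub>N\<^esub> = \<zero>\<^bsub>M\<^esub>"
  shows "subgroup H (add_monoid N)"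
  using assms by (simp add: subgroup_def m_inv_def)

section \<open>Categories of sets with structure\<close>

text \<open>The common shape of both representation categories, with \<open>U\<close> as the
  underlying set, so that laws of composition and the equivalence argument are treated once for
  both.\<close>

definition concrete_cat ::
  "'o set \<Rightarrow> ('o \<Rightarrow> 'o \<Rightarrow> ('v \<Rightarrow> 'v) set) \<Rightarrow> ('o \<Rightarrow> 'v set) \<Rightarrow> ('o, 'v \<Rightarrow> 'v) cat" where
  "concrete_cat Ob H U = \<lparr>Obj = Ob, Hom = H, Comp = \<lambda>M N Q g f. compose (U M) g f,
     Idm = \<lambda>M. \<lambda>v \<in> U M. v\<rparr>"

text \<open>Morphisms are extensional, so the restriction built into \<open>compose\<close> does no
  harm: associativity and the unit laws are those of functions, and only closure of the hom-sets
  depends on the structure.\<close>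

lemma category_concrete_cat:
  assumes hom: "\<And>M N. \<lbrakk>M \<in> Ob; N \<in> Ob\<rbrakk> \<Longrightarrow> H M N \<subseteq> U M \<rightarrow>\<^sub>E U N"
    and "\<And>M N Q f g. \<lbrakk>M \<in> Ob; N \<in> Ob; Q \<in> Ob; f \<in> H M N; g \<in> H N Q\<rbrakk> \<Longrightarrow> compose (U M) g f \<in> H M Q"
    and "\<And>M. M \<in> Ob \<Longrightarrow> (\<lambda>v \<in> U M. v) \<in> H M M"
  shows "category (concrete_cat Ob H U)"
proof
  have funcset: "f \<in> U M \<rightarrow> U N" "f \<in> extensional (U M)"
    if "f \<in> H M N" "M \<in> Ob" "N \<in> Ob" for f M N
    using hom[of M N] that by (auto simp: PiE_def)
  show "Comp (concrete_cat Ob H U) J N Q h (Comp (concrete_cat Ob H U) J M N g f)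
      = Comp (concrete_cat Ob H U) J M Q (Comp (concrete_cat Ob H U) M N Q h g) f"
    if "J \<in> Obj (concrete_cat Ob H U)" "M \<in> Obj (concrete_cat Ob H U)"
      "f \<in> Hom (concrete_cat Ob H U) J M" for J M N Q f g h
    using that funcset by (simp add: concrete_cat_def compose_assoc)
  show "Comp (concrete_cat Ob H U) M N N (Idm (concrete_cat Ob H U) N) f = f"
    "Comp (concrete_cat Ob H U) M M N f (Idm (concrete_cat Ob H U) M) = f"
    if "M \<in> Obj (concrete_cat Ob H U)" "N \<in> Obj (concrete_cat Ob H U)"
      "f \<in> Hom (concrete_cat Ob H U) M N" for M N f
    using that funcset[of f M N] by (simp_all add: concrete_cat_def)
qed (use assms in \<open>simp_all add: concrete_cat_def\<close>)

text \<open>An equivalence that leaves the underlying sets and maps untouched, so that identity maps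
  serve as unit and counit.\<close>

lemma equivalent_concrete_cats:
  assumes C: "category (concrete_cat Ob H U)" and D: "category (concrete_cat Ob' I W)"
    and homC: "\<And>M N. \<lbrakk>M \<in> Ob; N \<in> Ob\<rbrakk> \<Longrightarrow> H M N \<subseteq> U M \<rightarrow>\<^sub>E U N"
    and homD: "\<And>M N. \<lbrakk>M \<in> Ob'; N \<in> Ob'\<rbrakk> \<Longrightarrow> I M N \<subseteq> W M \<rightarrow>\<^sub>E W N"
    and F: "\<And>M. M \<in> Ob \<Longrightarrow> F M \<in> Ob'" "\<And>M. M \<in> Ob \<Longrightarrow> W (F M) = U M"
      "\<And>M N. \<lbrakk>M \<in> Ob; N \<in> Ob\<rbrakk> \<Longrightarrow> H M N \<subseteq> I (F M) (F N)"
    and G: "\<And>N. N \<in> Ob' \<Longrightarrow> G N \<in> Ob" "\<And>N. N \<in> Ob' \<Longrightarrow> U (G N) = W N"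
      "\<And>M N. \<lbrakk>M \<in> Ob'; N \<in> Ob'\<rbrakk> \<Longrightarrow> I M N \<subseteq> H (G M) (G N)"
    and GF: "\<And>M. M \<in> Ob \<Longrightarrow> (\<lambda>v \<in> U M. v) \<in> H M (G (F M)) \<inter> H (G (F M)) M"
    and FG: "\<And>N. N \<in> Ob' \<Longrightarrow> (\<lambda>v \<in> W N. v) \<in> I N (F (G N)) \<inter> I (F (G N)) N"
  shows "equivalent_categories (concrete_cat Ob H U) (concrete_cat Ob' I W)"
proof -
  have funC: "f \<in> U M \<rightarrow> U N" "f \<in> extensional (U M)" if "f \<in> H M N" "M \<in> Ob" "N \<in> Ob" for f M N
    using homC[of M N] that by (auto simp: PiE_def)
  have funD: "f \<in> W M \<rightarrow> W N" "f \<in> extensional (W M)" if "f \<in> I M N" "M \<in> Ob'" "N \<in> Ob'" for f M N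
    using homD[of M N] that by (auto simp: PiE_def)
  have "covariant_functor (concrete_cat Ob H U) (concrete_cat Ob' I W) F (\<lambda>M N f. f)"
    using F(1,2) F(3)[THEN subsetD] by unfold_locales (simp_all add: concrete_cat_def)
  moreover have "covariant_functor (concrete_cat Ob' I W) (concrete_cat Ob H U) G (\<lambda>M N f. f)"
    using G(1,2) G(3)[THEN subsetD] by unfold_locales (simp_all add: concrete_cat_def)
  moreover have "natural_iso (concrete_cat Ob H U) (concrete_cat Ob H U) (\<lambda>M. M) (\<lambda>M N f. f)
      (\<lambda>M. G (F M)) (\<lambda>M N f. f) (\<lambda>M. \<lambda>v \<in> U M. v)"
    unfolding natural_iso_def iso_arrow_def
  proof (intro conjI ballI)
    fix M assume "M \<in> Obj (concrete_cat Ob H U)"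
    then show "(\<lambda>v \<in> U M. v) \<in> Hom (concrete_cat Ob H U) M (G (F M))"
      "\<exists>g\<in>Hom (concrete_cat Ob H U) (G (F M)) M.
        Comp (concrete_cat Ob H U) M (G (F M)) M g (\<lambda>v \<in> U M. v) = Idm (concrete_cat Ob H U) M \<and>
        Comp (concrete_cat Ob H U) (G (F M)) M (G (F M)) (\<lambda>v \<in> U M. v) g
          = Idm (concrete_cat Ob H U) (G (F M))"
      using GF[of M] F(1,2) G(1,2) by (auto simp: concrete_cat_def intro!: bexI[of _ "\<lambda>v \<in> U M. v"])
  next
    fix M N f
    assume "M \<in> Obj (concrete_cat Ob H U)" "N \<in> Obj (concrete_cat Ob H U)"
      "f \<in> Hom (concrete_cat Ob H U) M N"
    then show "Comp (concrete_cat Ob H U) M N (G (F N)) (\<lambda>v \<in> U N. v) f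
        = Comp (concrete_cat Ob H U) M (G (F M)) (G (F N)) f (\<lambda>v \<in> U M. v)"
      using funC[of f M N] by (simp add: concrete_cat_def)
  qed
  moreover have "natural_iso (concrete_cat Ob' I W) (concrete_cat Ob' I W) (\<lambda>N. F (G N)) (\<lambda>M N f. f)
      (\<lambda>N. N) (\<lambda>M N f. f) (\<lambda>N. \<lambda>v \<in> W N. v)"
    unfolding natural_iso_def iso_arrow_def
  proof (intro conjI ballI)
    fix N assume "N \<in> Obj (concrete_cat Ob' I W)"
    then show "(\<lambda>v \<in> W N. v) \<in> Hom (concrete_cat Ob' I W) (F (G N)) N"
      "\<exists>g\<in>Hom (concrete_cat Ob' I W) N (F (G N)).
        Comp (concrete_cat Ob' I W) (F (G N)) N (F (G N)) g (\<lambda>v \<in> W N. v)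
          = Idm (concrete_cat Ob' I W) (F (G N)) \<and>
        Comp (concrete_cat Ob' I W) N (F (G N)) N (\<lambda>v \<in> W N. v) g = Idm (concrete_cat Ob' I W) N"
      using FG[of N] F(1,2) G(1,2) by (auto simp: concrete_cat_def intro!: bexI[of _ "\<lambda>v \<in> W N. v"])
  next
    fix M N f
    assume "M \<in> Obj (concrete_cat Ob' I W)" "N \<in> Obj (concrete_cat Ob' I W)"
      "f \<in> Hom (concrete_cat Ob' I W) M N"
    then show "Comp (concrete_cat Ob' I W) (F (G M)) (F (G N)) N (\<lambda>v \<in> W N. v) f
        = Comp (concrete_cat Ob' I W) (F (G M)) M N f (\<lambda>v \<in> W M. v)"
      using funD[of f M N] F(1,2) G(1,2) by (simp add: concrete_cat_def)
  qed
  ultimately show ?thesis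
    using C D unfolding equivalent_categories_def by blast
qed

section \<open>The Galois group and the trace\<close>

locale finite_galois_extension = galois_extension L K + G: group "galois_group L K"
  for L (structure) and K +
  assumes finite_galois_group: "finite (carrier (galois_group L K))"
begin

abbreviation Gal where "Gal \<equiv> carrier (galois_group L K)"

lemma K_subset: "K \<subseteq> carrier L"
  using fixed_field by auto

lemma Gal_hom: "\<sigma> \<in> Gal \<Longrightarrow> \<sigma> \<in> ring_hom L L"
  and Gal_fixes: "\<lbrakk>\<sigma> \<in> Gal; k \<in> K\<rbrakk> \<Longrightarrow> \<sigma> k = k"
  and Gal_Bij: "\<sigma> \<in> Gal \<Longrightarrow> \<sigma> \<in> Bij (carrier L)"
  by (auto simp: galois_group_def)

lemma Gal_closed [simp]: "\<lbrakk>\<sigma> \<in> Gal; a \<in> carrier L\<rbrakk> \<Longrightarrow> \<sigma> a \<in> carrier L"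
  using Gal_hom ring_hom_closed by fastforce

lemma Gal_add: "\<lbrakk>\<sigma> \<in> Gal; a \<in> carrier L; b \<in> carrier L\<rbrakk> \<Longrightarrow> \<sigma> (a \<oplus> b) = \<sigma> a \<oplus> \<sigma> b"
  and Gal_mult: "\<lbrakk>\<sigma> \<in> Gal; a \<in> carrier L; b \<in> carrier L\<rbrakk> \<Longrightarrow> \<sigma> (a \<otimes> b) = \<sigma> a \<otimes> \<sigma> b"
  using Gal_hom ring_hom_add ring_hom_mult by fastforce+

lemma Gal_finsum:
  assumes "\<sigma> \<in> Gal" "finite I" "g \<in> I \<rightarrow> carrier L"
  shows "\<sigma> (\<Oplus>i\<in>I. g i) = (\<Oplus>i\<in>I. \<sigma> (g i))"
  using assms by (intro additive_finsum[OF is_abelian_group is_abelian_group]) (auto simp: Gal_add)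

lemma one_Gal: "\<one>\<^bsub>galois_group L K\<^esub> = (\<lambda>a \<in> carrier L. a)"
  by (simp add: galois_group_def BijGroup_def)

lemma mult_Gal: "\<lbrakk>\<sigma> \<in> Gal; \<tau> \<in> Gal\<rbrakk> \<Longrightarrow> \<sigma> \<otimes>\<^bsub>galois_group L K\<^esub> \<tau> = compose (carrier L) \<sigma> \<tau>"
  by (simp add: galois_group_def BijGroup_def)

lemma Gal_comp: "\<lbrakk>\<sigma> \<in> Gal; \<tau> \<in> Gal; a \<in> carrier L\<rbrakk> \<Longrightarrow> (\<sigma> \<otimes>\<^bsub>galois_group L K\<^esub> \<tau>) a = \<sigma> (\<tau> a)"
  by (simp add: mult_Gal compose_eq)

lemma Gal_eqI:
  assumes "\<sigma> \<in> Gal" "\<tau> \<in> Gal" "\<And>a. a \<in> carrier L \<Longrightarrow> \<sigma> a = \<tau> a"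
  shows "\<sigma> = \<tau>"
  using assms Gal_Bij by (meson Bij_imp_extensional extensionalityI)

text \<open>An injective map of a finite set into itself is onto. Both facts serve to reindex sums
  over the Galois group.\<close>

lemma bij_left_translation:
  assumes "\<sigma> \<in> Gal"
  shows "inj_on (\<lambda>\<tau>. \<sigma> \<otimes>\<^bsub>galois_group L K\<^esub> \<tau>) Gal"
    "(\<lambda>\<tau>. \<sigma> \<otimes>\<^bsub>galois_group L K\<^esub> \<tau>) ` Gal = Gal"
proof -
  show "inj_on (\<lambda>\<tau>. \<sigma> \<otimes>\<^bsub>galois_group L K\<^esub> \<tau>) Gal"
    using assms by (rule G.inj_on_cmult)
  then show "(\<lambda>\<tau>. \<sigma> \<otimes>\<^bsub>galois_group L K\<^esub> \<tau>) ` Gal = Gal"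
    using assms finite_galois_group by (intro endo_inj_surj) auto
qed

definition trace :: "'a \<Rightarrow> 'a" where "trace b = (\<Oplus>\<sigma>\<in>Gal. \<sigma> b)"

text \<open>An automorphism permutes the summands of the trace by left translation, so the trace is
  fixed by the whole group, and the fixed field is \<open>K\<close>.\<close>

lemma trace_in_K:
  assumes "b \<in> carrier L"
  shows "trace b \<in> K"
proof -
  have closed: "trace b \<in> carrier L"
    using assms by (auto simp: trace_def intro!: finsum_closed)
  moreover have "\<sigma> (trace b) = trace b" if "\<sigma> \<in> Gal" for \<sigma>
  proof -
    have "\<sigma> (trace b) = (\<Oplus>\<tau>\<in>Gal. \<sigma> (\<tau> b))"
      unfolding trace_def using that assms finite_galois_group by (intro Gal_finsum) auto
    also have "\<dots> = (\<Oplus>\<tau>\<in>Gal. (\<sigma> \<otimes>\<^bsub>galois_group L K\<^esub> \<tau>) b)"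
      using that assms by (intro finsum_cong') (auto simp: Gal_comp)
    also have "\<dots> = (\<Oplus>\<tau>\<in>(\<lambda>\<tau>. \<sigma> \<otimes>\<^bsub>galois_group L K\<^esub> \<tau>) ` Gal. \<tau> b)"
      using that assms bij_left_translation by (intro finsum_reindex[symmetric]) auto
    also have "\<dots> = trace b"
      using bij_left_translation[OF that] by (simp add: trace_def)
    finally show ?thesis .
  qed
  ultimately show ?thesis
    using fixed_field by blast
qed

section \<open>Separating coordinates\<close>

text \<open>The families stand for the element z = \<Sum> x_i \<otimes> y_i of L \<otimes> L, and a
  \<otimes> b \<mapsto> a \<sigma>(b) is a ring homomorphism to L for each \<sigma>. Starting from 1
  \<otimes> 1, one factor is multiplied on for each \<sigma> in \<open>F\<close>; it has value 1 at
  the identity and 0 at \<sigma>. Values are multiplicative, so zeros obtained earlier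
  survive.\<close>

lemma exists_separating_coordinates:
  assumes "finite F" "F \<subseteq> Gal - {\<one>\<^bsub>galois_group L K\<^esub>}"
  shows "\<exists>(n::nat) x y. x \<in> {..<n} \<rightarrow> carrier L \<and> y \<in> {..<n} \<rightarrow> carrier L \<and>
    (\<Oplus>i\<in>{..<n}. x i \<otimes> y i) = \<one> \<and> (\<forall>\<sigma>\<in>F. (\<Oplus>i\<in>{..<n}. x i \<otimes> \<sigma> (y i)) = \<zero>)"
  using assms
proof (induction F)
  case empty
  show ?case
    by (intro exI[of _ "1::nat"] exI[of _ "\<lambda>_. \<one>"]) (simp add: lessThan_Suc finsum_insert)
next
  case (insert \<sigma> F)
  then obtain n :: nat and x y where
    xy: "x \<in> {..<n} \<rightarrow> carrier L" "y \<in> {..<n} \<rightarrow> carrier L"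
    and one: "(\<Oplus>i\<in>{..<n}. x i \<otimes> y i) = \<one>"
    and F: "\<And>\<tau>. \<tau> \<in> F \<Longrightarrow> (\<Oplus>i\<in>{..<n}. x i \<otimes> \<tau> (y i)) = \<zero>"
    by auto
  have \<sigma>: "\<sigma> \<in> Gal" "\<sigma> \<noteq> \<one>\<^bsub>galois_group L K\<^esub>"
    using insert by auto
  then obtain c where c: "c \<in> carrier L" "\<sigma> c \<noteq> c"
    using Gal_eqI[OF \<sigma>(1) G.one_closed] by (auto simp: one_Gal)
  define d where "d = inv (\<sigma> c \<ominus> c)"
  have "\<sigma> c \<ominus> c \<noteq> \<zero>"
    using c \<sigma> by simp
  then have "\<sigma> c \<ominus> c \<in> Units L"
    using c \<sigma> by (simp add: field_Units)
  then have d: "d \<in> carrier L" "d \<otimes> (\<sigma> c \<ominus> c) = \<one>"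
    by (simp_all add: d_def)
  \<comment> \<open>Multiply $\sum x_i \otimes y_i$ in $L \otimes L$ by
    $(\sigma(c) \otimes 1 - 1 \otimes c)/(\sigma(c) - c)$.\<close>
  define x' where "x' i = (if i < n then x i \<otimes> (d \<otimes> \<sigma> c) else \<ominus> (x (i - n) \<otimes> d))" for i
  define y' where "y' i = (if i < n then y i else y (i - n) \<otimes> c)" for i
  have x': "x' \<in> {..<n + n} \<rightarrow> carrier L" and y': "y' \<in> {..<n + n} \<rightarrow> carrier L"
    using xy c d \<sigma> by (auto simp: x'_def y'_def Pi_iff)
  have x'y': "x' i \<otimes> \<tau> (y' i) \<in> carrier L" if "\<tau> \<in> Gal" "i < n + n" for \<tau> i
    using x' y' that by (simp add: Pi_iff)
  \<comment> \<open>The product has 2n terms: those below \<open>n\<close> carry d \<sigma>(c) in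
    the left slot, those shifted by \<open>n\<close> carry -d on the left and c on the right. At
    \<tau> the old value is thus multiplied by d (\<sigma>(c) - \<tau>(c)), which is 1 for the
    identity and 0 for \<tau> = \<sigma>, while for \<tau> in \<open>F\<close> the old value is
    already 0.\<close>
  have sum: "(\<Oplus>i\<in>{..<n + n}. x' i \<otimes> \<tau> (y' i))
      = (\<Oplus>i\<in>{..<n}. x i \<otimes> \<tau> (y i)) \<otimes> (d \<otimes> (\<sigma> c \<ominus> \<tau> c))" if \<tau>: "\<tau> \<in> Gal" for \<tau>
  proof -
    have in_L: "x i \<in> carrier L" "y i \<in> carrier L" if "i < n" for i
      using xy that by (simp_all add: Pi_iff)
    have split: "{..<n + n} = {..<n} \<union> (\<lambda>i. i + n) ` {..<n}"
      unfolding lessThan_atLeast0 image_add_atLeastLessThan' by auto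
    have "(\<Oplus>i\<in>{..<n + n}. x' i \<otimes> \<tau> (y' i))
        = (\<Oplus>i\<in>{..<n}. x' i \<otimes> \<tau> (y' i)) \<oplus> (\<Oplus>i\<in>(\<lambda>i. i + n) ` {..<n}. x' i \<otimes> \<tau> (y' i))"
      using x'y' \<tau> by (subst split, intro finsum_Un_disjoint) auto
    also have "(\<Oplus>i\<in>(\<lambda>i. i + n) ` {..<n}. x' i \<otimes> \<tau> (y' i))
        = (\<Oplus>i\<in>{..<n}. x' (i + n) \<otimes> \<tau> (y' (i + n)))"
      using x'y' \<tau> by (intro finsum_reindex) auto
    also have "(\<Oplus>i\<in>{..<n}. x' i \<otimes> \<tau> (y' i)) \<oplus> (\<Oplus>i\<in>{..<n}. x' (i + n) \<otimes> \<tau> (y' (i + n)))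
        = (\<Oplus>i\<in>{..<n}. x' i \<otimes> \<tau> (y' i) \<oplus> x' (i + n) \<otimes> \<tau> (y' (i + n)))"
      using x'y' \<tau> by (intro finsum_addf[symmetric]) auto
    also have "\<dots> = (\<Oplus>i\<in>{..<n}. (x i \<otimes> \<tau> (y i)) \<otimes> (d \<otimes> (\<sigma> c \<ominus> \<tau> c)))"
    proof (intro finsum_cong' refl)
      show "x' i \<otimes> \<tau> (y' i) \<oplus> x' (i + n) \<otimes> \<tau> (y' (i + n))
          = (x i \<otimes> \<tau> (y i)) \<otimes> (d \<otimes> (\<sigma> c \<ominus> \<tau> c))" if "i \<in> {..<n}" for i
        using that in_L[of i] \<tau> \<sigma> c d(1) Gal_closed[OF \<tau>] Gal_closed[OF \<sigma>(1)]
        by (simp add: x'_def y'_def Gal_mult a_minus_def r_distr l_minus r_minus m_ac)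
    qed (use in_L \<tau> \<sigma> c d in auto)
    also have "\<dots> = (\<Oplus>i\<in>{..<n}. x i \<otimes> \<tau> (y i)) \<otimes> (d \<otimes> (\<sigma> c \<ominus> \<tau> c))"
      using in_L \<tau> \<sigma> c d by (intro finsum_ldistr[symmetric]) auto
    finally show ?thesis .
  qed
  have one_apply: "(\<Oplus>i\<in>{..<m}. f i \<otimes> \<one>\<^bsub>galois_group L K\<^esub> (g i)) = (\<Oplus>i\<in>{..<m}. f i \<otimes> g i)"
    if "f \<in> {..<m} \<rightarrow> carrier L" "g \<in> {..<m} \<rightarrow> carrier L" for m :: nat and f g
    using that by (intro finsum_cong') (auto simp: one_Gal Pi_iff)
  have "(\<Oplus>i\<in>{..<n + n}. x' i \<otimes> y' i) = \<one>"
    using sum[OF G.one_closed] one_apply[OF xy] one_apply[OF x' y'] one c d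
    by (simp add: one_Gal)
  moreover have "(\<Oplus>i\<in>{..<n + n}. x' i \<otimes> \<tau> (y' i)) = \<zero>" if "\<tau> \<in> insert \<sigma> F" for \<tau>
  proof -
    have \<tau>: "\<tau> \<in> Gal" using insert that by auto
    have "(\<Oplus>i\<in>{..<n}. x i \<otimes> \<tau> (y i)) \<in> carrier L"
      using xy \<tau> by (intro finsum_closed) (auto simp: Pi_iff)
    then show ?thesis
      using that F sum[OF \<tau>] \<tau> c d \<sigma> by (auto simp: r_neg a_minus_def)
  qed
  ultimately show ?case
    using x' y' by blast
qed

section \<open>The endomorphism ring with reversed product\<close>

abbreviation A where "A \<equiv> opposite_ring (End_K L K)"

lemma End_sel:
  "\<zero>\<^bsub>A\<^esub> = (\<lambda>a \<in> carrier L. \<zero>)"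
  "\<one>\<^bsub>A\<^esub> = (\<lambda>a \<in> carrier L. a)"
  "h \<oplus>\<^bsub>A\<^esub> h' = (\<lambda>a \<in> carrier L. h a \<oplus> h' a)"
  "h \<otimes>\<^bsub>A\<^esub> h' = compose (carrier L) h' h"
  by (simp_all add: opposite_ring_def End_K_def)

lemma EndI:
  assumes "h \<in> extensional (carrier L)"
    and "\<And>a. a \<in> carrier L \<Longrightarrow> h a \<in> carrier L"
    and "\<And>a b. \<lbrakk>a \<in> carrier L; b \<in> carrier L\<rbrakk> \<Longrightarrow> h (a \<oplus> b) = h a \<oplus> h b"
    and "\<And>k a. \<lbrakk>k \<in> K; a \<in> carrier L\<rbrakk> \<Longrightarrow> h (k \<otimes> a) = k \<otimes> h a"
  shows "h \<in> carrier A"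
  using assms by (auto simp: opposite_ring_def End_K_def PiE_def)

lemma
  assumes "h \<in> carrier A"
  shows End_closed [simp]: "a \<in> carrier L \<Longrightarrow> h a \<in> carrier L"
    and End_add: "\<lbrakk>a \<in> carrier L; b \<in> carrier L\<rbrakk> \<Longrightarrow> h (a \<oplus> b) = h a \<oplus> h b"
    and End_smult: "\<lbrakk>k \<in> K; a \<in> carrier L\<rbrakk> \<Longrightarrow> h (k \<otimes> a) = k \<otimes> h a"
    and End_extensional: "h \<in> extensional (carrier L)"
  using assms by (auto simp: opposite_ring_def End_K_def PiE_def)

lemma End_eqI:
  assumes "h \<in> carrier A" "h' \<in> carrier A" "\<And>a. a \<in> carrier L \<Longrightarrow> h a = h' a"
  shows "h = h'"
  using assms End_extensional extensionalityI by blast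

lemma ring_End: "ring A"
proof (intro ringI abelian_groupI monoidI)
  note K = K_subset[THEN subsetD]
  show "f \<oplus>\<^bsub>A\<^esub> g \<in> carrier A" if "f \<in> carrier A" "g \<in> carrier A" for f g
    using that K by (intro EndI) (auto simp: End_sel End_add End_smult a_ac r_distr)
  show zero: "\<zero>\<^bsub>A\<^esub> \<in> carrier A"
    using K by (intro EndI) (auto simp: End_sel)
  show "f \<otimes>\<^bsub>A\<^esub> g \<in> carrier A" if "f \<in> carrier A" "g \<in> carrier A" for f g
    using that K by (intro EndI) (auto simp: End_sel compose_eq End_add End_smult)
  show "\<one>\<^bsub>A\<^esub> \<in> carrier A"
    using K by (intro EndI) (auto simp: End_sel)
  show "(f \<oplus>\<^bsub>A\<^esub> g) \<oplus>\<^bsub>A\<^esub> h = f \<oplus>\<^bsub>A\<^esub> (g \<oplus>\<^bsub>A\<^esub> h)"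
    if "f \<in> carrier A" "g \<in> carrier A" "h \<in> carrier A" for f g h
    using that by (auto simp: End_sel a_assoc restrict_def)
  show "f \<oplus>\<^bsub>A\<^esub> g = g \<oplus>\<^bsub>A\<^esub> f" if "f \<in> carrier A" "g \<in> carrier A" for f g
    using that by (auto simp: End_sel a_comm restrict_def)
  show "\<zero>\<^bsub>A\<^esub> \<oplus>\<^bsub>A\<^esub> f = f" if "f \<in> carrier A" for f
    using that zero End_extensional
    by (intro extensionalityI[of _ "carrier L"]) (auto simp: End_sel)
  show "\<exists>g\<in>carrier A. g \<oplus>\<^bsub>A\<^esub> f = \<zero>\<^bsub>A\<^esub>" if f: "f \<in> carrier A" for f
  proof
    show "(\<lambda>a \<in> carrier L. \<ominus> f a) \<in> carrier A"
      using f K by (intro EndI) (auto simp: End_add End_smult minus_add r_minus)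
    show "(\<lambda>a \<in> carrier L. \<ominus> f a) \<oplus>\<^bsub>A\<^esub> f = \<zero>\<^bsub>A\<^esub>"
      using f by (auto simp: End_sel l_neg restrict_def)
  qed
  show "(f \<otimes>\<^bsub>A\<^esub> g) \<otimes>\<^bsub>A\<^esub> h = f \<otimes>\<^bsub>A\<^esub> (g \<otimes>\<^bsub>A\<^esub> h)"
    if "f \<in> carrier A" "g \<in> carrier A" "h \<in> carrier A" for f g h
    using that by (auto simp: End_sel compose_def restrict_def)
  show "\<one>\<^bsub>A\<^esub> \<otimes>\<^bsub>A\<^esub> f = f" "f \<otimes>\<^bsub>A\<^esub> \<one>\<^bsub>A\<^esub> = f" if "f \<in> carrier A" for f
    using that End_extensional
    by (auto simp: End_sel compose_eq intro!: extensionalityI[of _ "carrier L"])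
  show "(f \<oplus>\<^bsub>A\<^esub> g) \<otimes>\<^bsub>A\<^esub> h = f \<otimes>\<^bsub>A\<^esub> h \<oplus>\<^bsub>A\<^esub> g \<otimes>\<^bsub>A\<^esub> h"
    "h \<otimes>\<^bsub>A\<^esub> (f \<oplus>\<^bsub>A\<^esub> g) = h \<otimes>\<^bsub>A\<^esub> f \<oplus>\<^bsub>A\<^esub> h \<otimes>\<^bsub>A\<^esub> g"
    if "f \<in> carrier A" "g \<in> carrier A" "h \<in> carrier A" for f g h
    using that by (auto simp: End_sel compose_def End_add restrict_def)
qed

sublocale A: ring A
  by (rule ring_End)

text \<open>Members of \<open>Bij\<close> are extensional, so an automorphism is literally an
  element of \<open>A\<close> and no embedding is required. Linearity over \<open>K\<close> is
  multiplicativity together with fixing \<open>K\<close>.\<close>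

lemma Gal_in_End [simp]: "\<sigma> \<in> Gal \<Longrightarrow> \<sigma> \<in> carrier A"
  using K_subset Gal_Bij Bij_imp_extensional
  by (intro EndI) (auto simp: Gal_add Gal_mult Gal_fixes subset_eq)

lemma mult_map_in_End [simp]: "a \<in> carrier L \<Longrightarrow> mult_map L a \<in> carrier A"
  using K_subset by (intro EndI) (auto simp: mult_map_def r_distr subset_eq m_lcomm)

lemma mult_map_apply [simp]: "b \<in> carrier L \<Longrightarrow> mult_map L a b = a \<otimes> b"
  by (simp add: mult_map_def)

text \<open>The left factor acts first, so a product in \<open>A\<close> is read in the order in
  which its factors hit a vector from the right.\<close>

lemma End_mult_apply: "a \<in> carrier L \<Longrightarrow> (h \<otimes>\<^bsub>A\<^esub> h') a = h' (h a)"
  by (simp add: End_sel compose_eq)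

lemma End_add_apply: "a \<in> carrier L \<Longrightarrow> (h \<oplus>\<^bsub>A\<^esub> h') a = h a \<oplus> h' a"
  by (simp add: End_sel)

lemma End_zero_apply: "a \<in> carrier L \<Longrightarrow> \<zero>\<^bsub>A\<^esub> a = \<zero>"
  by (simp add: End_sel)

lemma End_one_apply: "a \<in> carrier L \<Longrightarrow> \<one>\<^bsub>A\<^esub> a = a"
  by (simp add: End_sel)

text \<open>Evaluation at \<open>a\<close> is an additive map from \<open>A\<close> to
  \<open>L\<close>.\<close>

lemma End_finsum_apply:
  assumes "finite I" "f \<in> I \<rightarrow> carrier A" "a \<in> carrier L"
  shows "(\<Oplus>\<^bsub>A\<^esub>i\<in>I. f i) a = (\<Oplus>i\<in>I. f i a)"
  using assms
  by (intro additive_finsum[OF A.is_abelian_group is_abelian_group, where f = "\<lambda>h. h a"])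
    (auto simp: End_sel)

lemma End_apply_finsum:
  assumes "h \<in> carrier A" "finite I" "f \<in> I \<rightarrow> carrier L"
  shows "h (\<Oplus>i\<in>I. f i) = (\<Oplus>i\<in>I. h (f i))"
  using assms by (intro additive_finsum[OF is_abelian_group is_abelian_group]) (auto simp: End_add)

end


section \<open>From spaces with Galois action to modules over \<open>A\<close>\<close>

locale galois_coordinates = finite_galois_extension +
  fixes n :: nat and x y :: "nat \<Rightarrow> 'a"
  assumes x_closed [simp]: "i < n \<Longrightarrow> x i \<in> carrier L"
    and y_closed [simp]: "i < n \<Longrightarrow> y i \<in> carrier L"
    and separating: "\<sigma> \<in> Gal \<Longrightarrow>
      (\<Oplus>i\<in>{..<n}. x i \<otimes> \<sigma> (y i)) = (if \<sigma> = \<one>\<^bsub>galois_group L K\<^esub> then \<one> else \<zero>)"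
begin

text \<open>After expanding the traces and exchanging the sums, \<sigma>(b) has the coefficient
  \<Sum> x_i \<sigma>(y_i), which is 1 for the identity and 0 otherwise. So the x_i with the
  functionals b \<mapsto> tr(y_i b) behave like a dual basis.\<close>

lemma trace_expansion:
  assumes "b \<in> carrier L"
  shows "(\<Oplus>i\<in>{..<n}. x i \<otimes> trace (y i \<otimes> b)) = b"
proof -
  have "(\<Oplus>i\<in>{..<n}. x i \<otimes> trace (y i \<otimes> b)) = (\<Oplus>i\<in>{..<n}. \<Oplus>\<sigma>\<in>Gal. x i \<otimes> \<sigma> (y i) \<otimes> \<sigma> b)"
  proof (intro finsum_cong' refl)
    show "x i \<otimes> trace (y i \<otimes> b) = (\<Oplus>\<sigma>\<in>Gal. x i \<otimes> \<sigma> (y i) \<otimes> \<sigma> b)" if "i \<in> {..<n}" for i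
      using that assms finite_galois_group
      by (simp add: trace_def finsum_rdistr Gal_mult m_assoc Pi_iff cong: finsum_cong)
  qed (use assms in \<open>auto intro!: finsum_closed\<close>)
  also have "\<dots> = (\<Oplus>\<sigma>\<in>Gal. \<Oplus>i\<in>{..<n}. x i \<otimes> \<sigma> (y i) \<otimes> \<sigma> b)"
    using assms finite_galois_group by (intro finsum_swap) auto
  also have "\<dots> = (\<Oplus>\<sigma>\<in>Gal. if \<sigma> = \<one>\<^bsub>galois_group L K\<^esub> then b else \<zero>)"
  proof (intro finsum_cong' refl)
    show "(\<Oplus>i\<in>{..<n}. x i \<otimes> \<sigma> (y i) \<otimes> \<sigma> b)
        = (if \<sigma> = \<one>\<^bsub>galois_group L K\<^esub> then b else \<zero>)" if "\<sigma> \<in> Gal" for \<sigma>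
      using that assms separating[OF that]
      by (simp add: finsum_ldistr[symmetric] Pi_iff) (simp add: one_Gal)
  qed (use assms in auto)
  also have "\<dots> = b"
    using assms finite_galois_group by (intro finsum_delta) auto
  finally show ?thesis .
qed

definition orbit_sum :: "('a, 'v) module \<Rightarrow> (('a \<Rightarrow> 'a) \<Rightarrow> 'v \<Rightarrow> 'v) \<Rightarrow> 'v \<Rightarrow> 'v" where
  "orbit_sum V s w = (\<Oplus>\<^bsub>V\<^esub>\<sigma>\<in>Gal. s \<sigma> w)"

definition end_act :: "('a, 'v) module \<Rightarrow> (('a \<Rightarrow> 'a) \<Rightarrow> 'v \<Rightarrow> 'v) \<Rightarrow> 'v \<Rightarrow> ('a \<Rightarrow> 'a) \<Rightarrow> 'v" where
  "end_act V s v h = (\<Oplus>\<^bsub>V\<^esub>i\<in>{..<n}. h (x i) \<odot>\<^bsub>V\<^esub> orbit_sum V s (y i \<odot>\<^bsub>V\<^esub> v))"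

context
  fixes V :: "('a, 'v) module" and s :: "('a \<Rightarrow> 'a) \<Rightarrow> 'v \<Rightarrow> 'v"
  assumes V: "galois_space L K V s"
begin

interpretation V: galois_space L K V s
  by (rule V)

lemma smult_finsum:
  assumes "a \<in> carrier L" "finite I" "f \<in> I \<rightarrow> carrier V"
  shows "a \<odot>\<^bsub>V\<^esub> (\<Oplus>\<^bsub>V\<^esub>i\<in>I. f i) = (\<Oplus>\<^bsub>V\<^esub>i\<in>I. a \<odot>\<^bsub>V\<^esub> f i)"
  using assms
  by (intro additive_finsum[OF V.M.abelian_group_axioms V.M.abelian_group_axioms])
    (auto simp: V.smult_r_distr)

lemma finsum_smult:
  assumes "v \<in> carrier V" "finite I" "f \<in> I \<rightarrow> carrier L"
  shows "(\<Oplus>i\<in>I. f i) \<odot>\<^bsub>V\<^esub> v = (\<Oplus>\<^bsub>V\<^esub>i\<in>I. f i \<odot>\<^bsub>V\<^esub> v)"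
  using assms
  by (intro additive_finsum[OF is_abelian_group V.M.abelian_group_axioms, where f = "\<lambda>a. a \<odot>\<^bsub>V\<^esub> v"])
    (auto simp: V.smult_l_distr)

lemma act_finsum:
  assumes "\<sigma> \<in> Gal" "finite I" "f \<in> I \<rightarrow> carrier V"
  shows "s \<sigma> (\<Oplus>\<^bsub>V\<^esub>i\<in>I. f i) = (\<Oplus>\<^bsub>V\<^esub>i\<in>I. s \<sigma> (f i))"
  using assms
  by (intro additive_finsum[OF V.M.abelian_group_axioms V.M.abelian_group_axioms])
    (auto simp: V.act_closed V.act_add)

lemma orbit_sum_closed: "w \<in> carrier V \<Longrightarrow> orbit_sum V s w \<in> carrier V"
  by (auto simp: orbit_sum_def V.act_closed intro!: V.M.finsum_closed)

lemma orbit_sum_add: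
  "\<lbrakk>v \<in> carrier V; w \<in> carrier V\<rbrakk>
    \<Longrightarrow> orbit_sum V s (v \<oplus>\<^bsub>V\<^esub> w) = orbit_sum V s v \<oplus>\<^bsub>V\<^esub> orbit_sum V s w"
  by (simp add: orbit_sum_def V.act_add V.act_closed V.M.finsum_addf Pi_iff cong: V.M.finsum_cong)

lemma orbit_sum_finsum:
  assumes "finite I" "f \<in> I \<rightarrow> carrier V"
  shows "orbit_sum V s (\<Oplus>\<^bsub>V\<^esub>i\<in>I. f i) = (\<Oplus>\<^bsub>V\<^esub>i\<in>I. orbit_sum V s (f i))"
  using assms
  by (intro additive_finsum[OF V.M.abelian_group_axioms V.M.abelian_group_axioms])
    (auto simp: orbit_sum_add orbit_sum_closed)

text \<open>Left translation permutes the summands. The vectors T(w) are therefore invariant, which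
  is what lets scalars be moved past the action below.\<close>

lemma act_orbit_sum:
  assumes "\<sigma> \<in> Gal" "w \<in> carrier V"
  shows "s \<sigma> (orbit_sum V s w) = orbit_sum V s w"
proof -
  let ?t = "\<lambda>\<tau>. \<sigma> \<otimes>\<^bsub>galois_group L K\<^esub> \<tau>"
  have "s \<sigma> (orbit_sum V s w) = (\<Oplus>\<^bsub>V\<^esub>\<tau>\<in>Gal. s \<sigma> (s \<tau> w))"
    unfolding orbit_sum_def using assms finite_galois_group by (intro act_finsum) (auto simp: V.act_closed)
  also have "\<dots> = (\<Oplus>\<^bsub>V\<^esub>\<tau>\<in>Gal. s (?t \<tau>) w)"
    using assms by (intro V.M.finsum_cong') (auto simp: V.act_mult V.act_closed)
  also have "\<dots> = (\<Oplus>\<^bsub>V\<^esub>\<tau>\<in>?t ` Gal. s \<tau> w)"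
    using assms bij_left_translation by (intro V.M.finsum_reindex[symmetric]) (auto simp: V.act_closed)
  also have "\<dots> = orbit_sum V s w"
    using bij_left_translation[OF assms(1)] by (simp add: orbit_sum_def)
  finally show ?thesis .
qed

text \<open>On an invariant vector the semilinear action moves only the scalar, so the sum over the
  group collects there as a trace.\<close>

lemma orbit_sum_smult:
  assumes "a \<in> carrier L" "w \<in> carrier V" "\<And>\<sigma>. \<sigma> \<in> Gal \<Longrightarrow> s \<sigma> w = w"
  shows "orbit_sum V s (a \<odot>\<^bsub>V\<^esub> w) = trace a \<odot>\<^bsub>V\<^esub> w"
proof -
  have "orbit_sum V s (a \<odot>\<^bsub>V\<^esub> w) = (\<Oplus>\<^bsub>V\<^esub>\<sigma>\<in>Gal. \<sigma> a \<odot>\<^bsub>V\<^esub> w)"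
    unfolding orbit_sum_def using assms by (intro V.M.finsum_cong') (auto simp: V.act_semilinear)
  then show ?thesis
    using assms finite_galois_group by (simp add: trace_def finsum_smult Pi_iff)
qed

lemma end_act_term_closed:
  "\<lbrakk>v \<in> carrier V; h \<in> carrier A; i < n\<rbrakk>
    \<Longrightarrow> h (x i) \<odot>\<^bsub>V\<^esub> orbit_sum V s (y i \<odot>\<^bsub>V\<^esub> v) \<in> carrier V"
  by (simp add: orbit_sum_closed)

lemma end_act_closed: "\<lbrakk>v \<in> carrier V; h \<in> carrier A\<rbrakk> \<Longrightarrow> end_act V s v h \<in> carrier V"
  by (auto simp: end_act_def end_act_term_closed intro!: V.M.finsum_closed)

lemma end_act_add_left:
  "\<lbrakk>v \<in> carrier V; w \<in> carrier V; h \<in> carrier A\<rbrakk>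
    \<Longrightarrow> end_act V s (v \<oplus>\<^bsub>V\<^esub> w) h = end_act V s v h \<oplus>\<^bsub>V\<^esub> end_act V s w h"
  by (simp add: end_act_def end_act_term_closed Pi_iff
      V.smult_r_distr orbit_sum_add orbit_sum_closed cong: V.M.finsum_cong)

lemma end_act_add_right:
  "\<lbrakk>v \<in> carrier V; h \<in> carrier A; h' \<in> carrier A\<rbrakk>
    \<Longrightarrow> end_act V s v (h \<oplus>\<^bsub>A\<^esub> h') = end_act V s v h \<oplus>\<^bsub>V\<^esub> end_act V s v h'"
  by (simp add: end_act_def end_act_term_closed Pi_iff
      V.smult_l_distr orbit_sum_closed End_sel cong: V.M.finsum_cong)

lemma end_act_finsum:
  assumes "v \<in> carrier V" "finite I" "f \<in> I \<rightarrow> carrier A"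
  shows "end_act V s v (\<Oplus>\<^bsub>A\<^esub>i\<in>I. f i) = (\<Oplus>\<^bsub>V\<^esub>i\<in>I. end_act V s v (f i))"
  using assms
  by (intro additive_finsum[OF A.is_abelian_group V.M.abelian_group_axioms])
    (auto simp: end_act_add_right end_act_closed)

text \<open>In this product \<open>h\<close> acts first and \<open>mult_map L a\<close> second, so
  each coefficient h(x_i) is multiplied by \<open>a\<close>.\<close>

lemma end_act_mult_map_comp:
  assumes "v \<in> carrier V" "h \<in> carrier A" "a \<in> carrier L"
  shows "end_act V s v (h \<otimes>\<^bsub>A\<^esub> mult_map L a) = a \<odot>\<^bsub>V\<^esub> end_act V s v h"
  using assms
  by (simp add: end_act_def end_act_term_closed smult_finsum End_mult_apply V.smult_assoc1
      orbit_sum_closed Pi_iff cong: V.M.finsum_cong)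

text \<open>The computation of \<open>trace_expansion\<close> with s_\<sigma>(v) in place of
  \<sigma>(b); semilinearity supplies the coefficients x_i \<sigma>(y_i).\<close>

lemma end_act_one:
  assumes "v \<in> carrier V"
  shows "end_act V s v \<one>\<^bsub>A\<^esub> = v"
proof -
  have "end_act V s v \<one>\<^bsub>A\<^esub> = (\<Oplus>\<^bsub>V\<^esub>i\<in>{..<n}. \<Oplus>\<^bsub>V\<^esub>\<sigma>\<in>Gal. (x i \<otimes> \<sigma> (y i)) \<odot>\<^bsub>V\<^esub> s \<sigma> v)"
    unfolding end_act_def
  proof (intro V.M.finsum_cong' refl)
    show "\<one>\<^bsub>A\<^esub> (x i) \<odot>\<^bsub>V\<^esub> orbit_sum V s (y i \<odot>\<^bsub>V\<^esub> v)
        = (\<Oplus>\<^bsub>V\<^esub>\<sigma>\<in>Gal. (x i \<otimes> \<sigma> (y i)) \<odot>\<^bsub>V\<^esub> s \<sigma> v)" if "i \<in> {..<n}" for i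
      using that assms finite_galois_group
      by (simp add: End_sel orbit_sum_def smult_finsum V.act_semilinear V.act_closed V.smult_assoc1
          Pi_iff cong: V.M.finsum_cong)
  qed (use assms in \<open>auto intro!: V.M.finsum_closed simp: V.act_closed\<close>)
  also have "\<dots> = (\<Oplus>\<^bsub>V\<^esub>\<sigma>\<in>Gal. \<Oplus>\<^bsub>V\<^esub>i\<in>{..<n}. (x i \<otimes> \<sigma> (y i)) \<odot>\<^bsub>V\<^esub> s \<sigma> v)"
    using assms finite_galois_group by (intro V.M.finsum_swap) (auto simp: V.act_closed)
  also have "\<dots> = (\<Oplus>\<^bsub>V\<^esub>\<sigma>\<in>Gal. if \<sigma> = \<one>\<^bsub>galois_group L K\<^esub> then v else \<zero>\<^bsub>V\<^esub>)"
  proof (intro V.M.finsum_cong' refl)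
    show "(\<Oplus>\<^bsub>V\<^esub>i\<in>{..<n}. (x i \<otimes> \<sigma> (y i)) \<odot>\<^bsub>V\<^esub> s \<sigma> v)
        = (if \<sigma> = \<one>\<^bsub>galois_group L K\<^esub> then v else \<zero>\<^bsub>V\<^esub>)" if "\<sigma> \<in> Gal" for \<sigma>
      using that assms by (simp add: finsum_smult[symmetric] Pi_iff separating V.act_closed V.act_id)
  qed (use assms in auto)
  also have "\<dots> = v"
    using assms finite_galois_group by (intro V.M.finsum_delta) auto
  finally show ?thesis .
qed

lemma end_act_mult_map:
  "\<lbrakk>v \<in> carrier V; a \<in> carrier L\<rbrakk> \<Longrightarrow> end_act V s v (mult_map L a) = a \<odot>\<^bsub>V\<^esub> v"
  using end_act_mult_map_comp[of v "\<one>\<^bsub>A\<^esub>" a] by (simp add: end_act_one)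

text \<open>Apply s_\<sigma> to the expansion of v given by \<open>end_act_one\<close>: the vectors
  T(y_i v) are invariant, and the coefficient x_i becomes \<sigma>(x_i).\<close>

lemma end_act_Gal:
  assumes "v \<in> carrier V" "\<sigma> \<in> Gal"
  shows "end_act V s v \<sigma> = s \<sigma> v"
proof -
  have "s \<sigma> v = s \<sigma> (end_act V s v \<one>\<^bsub>A\<^esub>)"
    using assms by (simp add: end_act_one)
  also have "\<dots> = end_act V s v \<sigma>"
    using assms
    by (simp add: end_act_def act_finsum V.act_semilinear End_sel orbit_sum_closed act_orbit_sum
        Pi_iff cong: V.M.finsum_cong)
  finally show ?thesis by simp
qed

text \<open>Put w_i = T(y_i v). As these are invariant, T sends y_j (v h), the sum of the y_j h(x_i)
  w_i, to the sum of the tr(y_j h(x_i)) w_i. Hence (v h) h' is a double sum over i and j whose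
  coefficients are h'(x_j) tr(y_j h(x_i)), and the sum over j can be evaluated inside h'.\<close>

lemma end_act_mult:
  assumes v: "v \<in> carrier V" and h: "h \<in> carrier A" and h': "h' \<in> carrier A"
  shows "end_act V s v (h \<otimes>\<^bsub>A\<^esub> h') = end_act V s (end_act V s v h) h'"
proof -
  define w where "w i = orbit_sum V s (y i \<odot>\<^bsub>V\<^esub> v)" for i
  have w: "w i \<in> carrier V" "\<And>\<sigma>. \<sigma> \<in> Gal \<Longrightarrow> s \<sigma> (w i) = w i" if "i < n" for i
    using that v by (auto simp: w_def orbit_sum_closed act_orbit_sum)
  have tr: "trace b \<in> K" "trace b \<in> carrier L" if "b \<in> carrier L" for b
    using trace_in_K[OF that] K_subset by auto
  have "end_act V s (end_act V s v h) h'
      = (\<Oplus>\<^bsub>V\<^esub>j\<in>{..<n}. \<Oplus>\<^bsub>V\<^esub>i\<in>{..<n}. h' (x j \<otimes> trace (y j \<otimes> h (x i))) \<odot>\<^bsub>V\<^esub> w i)"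
    unfolding end_act_def[of V s "end_act V s v h"]
  proof (intro V.M.finsum_cong' refl)
    fix j assume "j \<in> {..<n}"
    then have j: "j < n" by simp
    have "y j \<odot>\<^bsub>V\<^esub> end_act V s v h = (\<Oplus>\<^bsub>V\<^esub>i\<in>{..<n}. (y j \<otimes> h (x i)) \<odot>\<^bsub>V\<^esub> w i)"
      using j w h by (simp add: end_act_def w_def[symmetric] smult_finsum V.smult_assoc1
          Pi_iff cong: V.M.finsum_cong)
    also have "orbit_sum V s \<dots> = (\<Oplus>\<^bsub>V\<^esub>i\<in>{..<n}. trace (y j \<otimes> h (x i)) \<odot>\<^bsub>V\<^esub> w i)"
      using j w h tr by (simp add: orbit_sum_finsum orbit_sum_smult Pi_iff cong: V.M.finsum_cong)
    also have "h' (x j) \<odot>\<^bsub>V\<^esub> \<dots> = (\<Oplus>\<^bsub>V\<^esub>i\<in>{..<n}. (h' (x j) \<otimes> trace (y j \<otimes> h (x i))) \<odot>\<^bsub>V\<^esub> w i)"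
      using j w h h' tr by (simp add: smult_finsum V.smult_assoc1 Pi_iff cong: V.M.finsum_cong)
    \<comment> \<open>The trace lies in \<open>K\<close>, so the linear map \<open>h'\<close>
      absorbs it into its argument.\<close>
    also have "\<dots> = (\<Oplus>\<^bsub>V\<^esub>i\<in>{..<n}. h' (x j \<otimes> trace (y j \<otimes> h (x i))) \<odot>\<^bsub>V\<^esub> w i)"
    proof (intro V.M.finsum_cong' refl)
      fix i assume "i \<in> {..<n}"
      then show "(h' (x j) \<otimes> trace (y j \<otimes> h (x i))) \<odot>\<^bsub>V\<^esub> w i
          = h' (x j \<otimes> trace (y j \<otimes> h (x i))) \<odot>\<^bsub>V\<^esub> w i"
        using j h h' tr[of "y j \<otimes> h (x i)"] End_smult[OF h', of "trace (y j \<otimes> h (x i))" "x j"]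
        by (simp add: m_comm)
    qed (use j w h h' tr in auto)
    finally show "h' (x j) \<odot>\<^bsub>V\<^esub> orbit_sum V s (y j \<odot>\<^bsub>V\<^esub> end_act V s v h)
        = (\<Oplus>\<^bsub>V\<^esub>i\<in>{..<n}. h' (x j \<otimes> trace (y j \<otimes> h (x i))) \<odot>\<^bsub>V\<^esub> w i)" .
  qed (use w h h' tr in \<open>auto intro!: V.M.finsum_closed\<close>)
  also have "\<dots> = (\<Oplus>\<^bsub>V\<^esub>i\<in>{..<n}. \<Oplus>\<^bsub>V\<^esub>j\<in>{..<n}. h' (x j \<otimes> trace (y j \<otimes> h (x i))) \<odot>\<^bsub>V\<^esub> w i)"
    using w h h' tr by (intro V.M.finsum_swap) auto
  \<comment> \<open>For fixed i the sum over j moves into \<open>h'\<close>, where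
    \<open>trace_expansion\<close> reassembles h(x_i).\<close>
  also have "\<dots> = (\<Oplus>\<^bsub>V\<^esub>i\<in>{..<n}. h' (h (x i)) \<odot>\<^bsub>V\<^esub> w i)"
  proof (intro V.M.finsum_cong' refl)
    fix i assume "i \<in> {..<n}"
    then show "(\<Oplus>\<^bsub>V\<^esub>j\<in>{..<n}. h' (x j \<otimes> trace (y j \<otimes> h (x i))) \<odot>\<^bsub>V\<^esub> w i) = h' (h (x i)) \<odot>\<^bsub>V\<^esub> w i"
      using w h h' tr trace_expansion[of "h (x i)"]
        End_apply_finsum[OF h', of "{..<n}" "\<lambda>j. x j \<otimes> trace (y j \<otimes> h (x i))"]
      by (simp add: finsum_smult[symmetric] Pi_iff)
  qed (use w h h' tr in auto)
  finally show ?thesis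
    using w h h' by (simp add: end_act_def[of V s v] End_mult_apply w_def[symmetric] Pi_iff
        cong: V.M.finsum_cong)
qed

end


definition to_rmodule :: "('a, 'v) module \<Rightarrow> (('a \<Rightarrow> 'a) \<Rightarrow> 'v \<Rightarrow> 'v) \<Rightarrow> ('a \<Rightarrow> 'a, 'v) rmodule" where
  "to_rmodule V s = \<lparr>carrier = carrier V, mult = mult V, one = \<one>\<^bsub>V\<^esub>, zero = \<zero>\<^bsub>V\<^esub>,
     add = add V, ract = end_act V s\<rparr>"

lemma to_rmodule_sel [simp]:
  "carrier (to_rmodule V s) = carrier V" "add (to_rmodule V s) = add V"
  "\<zero>\<^bsub>to_rmodule V s\<^esub> = \<zero>\<^bsub>V\<^esub>" "ract (to_rmodule V s) = end_act V s"
  by (simp_all add: to_rmodule_def)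

lemma right_module_to_rmodule:
  assumes "galois_space L K V s"
  shows "right_module A (to_rmodule V s)"
proof -
  interpret V: galois_space L K V s by fact
  have "abelian_group (to_rmodule V s)"
    using V.M.abelian_group_axioms by (rule abelian_group_cong) simp_all
  then show ?thesis
    using assms
    by (intro right_module.intro right_module_axioms.intro ring_End)
      (simp_all add: end_act_closed end_act_add_left end_act_add_right end_act_mult end_act_one)
qed

section \<open>From modules over \<open>A\<close> to spaces with Galois action\<close>

context
  fixes W :: "('a \<Rightarrow> 'a, 'v) rmodule"
  assumes W: "right_module A W"
begin

interpretation W: right_module A W
  by (rule W)

lemma ract_finsum:
  assumes "v \<in> carrier W" "finite I" "f \<in> I \<rightarrow> carrier A"
  shows "v \<star>\<^bsub>W\<^esub> (\<Oplus>\<^bsub>A\<^esub>i\<in>I. f i) = (\<Oplus>\<^bsub>W\<^esub>i\<in>I. v \<star>\<^bsub>W\<^esub> f i)"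
  using assms
  by (intro additive_finsum[OF A.is_abelian_group W.V.abelian_group_axioms])
    (auto simp: W.ract_closed W.ract_add_right)

text \<open>The group acts through its elements in \<open>A\<close>. Two reversals cancel: the right
  action and the reversed product together give a left action of the Galois group.\<close>

lemma galois_space_of_rmodule:
  "galois_space L K (of_rmodule L W) (\<lambda>\<sigma> v. v \<star>\<^bsub>W\<^esub> \<sigma>)"
proof -
  have add: "mult_map L (a \<oplus> b) = mult_map L a \<oplus>\<^bsub>A\<^esub> mult_map L b"
    and mult: "mult_map L (a \<otimes> b) = mult_map L b \<otimes>\<^bsub>A\<^esub> mult_map L a"
    if "a \<in> carrier L" "b \<in> carrier L" for a b
    using that by (auto intro!: End_eqI simp: End_add_apply End_mult_apply l_distr m_assoc)
  have one: "mult_map L \<one> = \<one>\<^bsub>A\<^esub>"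
    by (rule End_eqI) (simp_all add: End_one_apply)
  have "abelian_group (of_rmodule L W)"
    using W.V.abelian_group_axioms by (rule abelian_group_cong) simp_all
  then have "module L (of_rmodule L W)"
    by (intro moduleI is_cring)
      (simp_all add: W.ract_closed add W.ract_add_right mult W.ract_mult one W.ract_one W.ract_add_left)
  moreover have comp: "(v \<star>\<^bsub>W\<^esub> \<sigma>) \<star>\<^bsub>W\<^esub> \<tau> = v \<star>\<^bsub>W\<^esub> (\<tau> \<otimes>\<^bsub>galois_group L K\<^esub> \<sigma>)"
    if "\<sigma> \<in> Gal" "\<tau> \<in> Gal" "v \<in> carrier W" for \<sigma> \<tau> v
    using that by (simp add: mult_Gal W.ract_mult[symmetric] End_sel)
  have semilinear: "(v \<star>\<^bsub>W\<^esub> mult_map L a) \<star>\<^bsub>W\<^esub> \<tau> = (v \<star>\<^bsub>W\<^esub> \<tau>) \<star>\<^bsub>W\<^esub> mult_map L (\<tau> a)"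
    if "\<tau> \<in> Gal" "v \<in> carrier W" "a \<in> carrier L" for \<tau> v a
  proof -
    \<comment> \<open>As composition of maps this says \<tau> \<circ> \<mu>_a = \<mu>_{\<tau>(a)}
      \<circ> \<tau>, which is multiplicativity of \<tau>.\<close>
    have "mult_map L a \<otimes>\<^bsub>A\<^esub> \<tau> = \<tau> \<otimes>\<^bsub>A\<^esub> mult_map L (\<tau> a)"
      using that by (intro End_eqI) (simp_all add: End_mult_apply Gal_mult)
    then show ?thesis
      using that by (simp add: W.ract_mult[symmetric])
  qed
  have id: "v \<star>\<^bsub>W\<^esub> \<one>\<^bsub>galois_group L K\<^esub> = v" if "v \<in> carrier W" for v
    using W.ract_one[OF that] by (simp add: one_Gal End_sel)
  show ?thesis
    using K_subset
    by (intro galois_space.intro galois_space_axioms.intro calculation)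
      (auto simp: W.ract_closed W.ract_add_left comp semilinear id Gal_fixes)
qed

text \<open>At b the inner sum takes the value tr(y_i b), which lies in \<open>K\<close>, so h(x_i)
  tr(y_i b) = h(x_i tr(y_i b)), and summation over i gives h(b) by \<open>trace_expansion\<close>.
  Thus multiplications and automorphisms generate \<open>A\<close>.\<close>

lemma End_expansion:
  assumes "h \<in> carrier A"
  shows "(\<Oplus>\<^bsub>A\<^esub>i\<in>{..<n}. (\<Oplus>\<^bsub>A\<^esub>\<sigma>\<in>Gal. mult_map L (y i) \<otimes>\<^bsub>A\<^esub> \<sigma>) \<otimes>\<^bsub>A\<^esub> mult_map L (h (x i))) = h"
proof (rule End_eqI)
  have inner: "(\<Oplus>\<^bsub>A\<^esub>\<sigma>\<in>Gal. mult_map L (y i) \<otimes>\<^bsub>A\<^esub> \<sigma>) \<in> carrier A" if "i < n" for i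
    using that by (auto intro!: A.finsum_closed)
  then show "(\<Oplus>\<^bsub>A\<^esub>i\<in>{..<n}. (\<Oplus>\<^bsub>A\<^esub>\<sigma>\<in>Gal. mult_map L (y i) \<otimes>\<^bsub>A\<^esub> \<sigma>) \<otimes>\<^bsub>A\<^esub> mult_map L (h (x i)))
      \<in> carrier A"
    using assms by (auto intro!: A.finsum_closed)
  fix b assume b: "b \<in> carrier L"
  have tr: "trace a \<in> K" "trace a \<in> carrier L" if "a \<in> carrier L" for a
    using trace_in_K[OF that] K_subset by auto
  have inner_apply: "(\<Oplus>\<^bsub>A\<^esub>\<sigma>\<in>Gal. mult_map L (y i) \<otimes>\<^bsub>A\<^esub> \<sigma>) b = trace (y i \<otimes> b)" if "i < n" for i
    using that b finite_galois_group
    by (simp add: trace_def End_finsum_apply End_mult_apply Pi_iff cong: finsum_cong)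
  have "(\<Oplus>\<^bsub>A\<^esub>i\<in>{..<n}. (\<Oplus>\<^bsub>A\<^esub>\<sigma>\<in>Gal. mult_map L (y i) \<otimes>\<^bsub>A\<^esub> \<sigma>) \<otimes>\<^bsub>A\<^esub> mult_map L (h (x i))) b
      = (\<Oplus>i\<in>{..<n}. h (x i) \<otimes> trace (y i \<otimes> b))"
    using assms b inner tr
    by (simp add: End_finsum_apply End_mult_apply inner_apply Pi_iff cong: finsum_cong)
  also have "\<dots> = (\<Oplus>i\<in>{..<n}. h (x i \<otimes> trace (y i \<otimes> b)))"
  proof (intro finsum_cong' refl)
    fix i assume "i \<in> {..<n}"
    then show "h (x i) \<otimes> trace (y i \<otimes> b) = h (x i \<otimes> trace (y i \<otimes> b))"
      using assms b tr[of "y i \<otimes> b"] End_smult[OF assms, of "trace (y i \<otimes> b)" "x i"]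
      by (simp add: m_comm)
  qed (use assms b tr in auto)
  also have "\<dots> = h b"
    using assms b tr trace_expansion[OF b]
      End_apply_finsum[OF assms, of "{..<n}" "\<lambda>i. x i \<otimes> trace (y i \<otimes> b)"]
    by (simp add: Pi_iff)
  finally show "(\<Oplus>\<^bsub>A\<^esub>i\<in>{..<n}. (\<Oplus>\<^bsub>A\<^esub>\<sigma>\<in>Gal. mult_map L (y i) \<otimes>\<^bsub>A\<^esub> \<sigma>) \<otimes>\<^bsub>A\<^esub> mult_map L (h (x i))) b
      = h b" .
qed fact

text \<open>Letting the expansion of \<open>h\<close> act on \<open>v\<close> factor by factor
  yields the defining formula of \<open>end_act\<close>. So the action of \<open>A\<close> is
  determined by its restriction to scalars and automorphisms.\<close>

lemma end_act_of_rmodule: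
  assumes "v \<in> carrier W" "h \<in> carrier A"
  shows "end_act (of_rmodule L W) (\<lambda>\<sigma> v. v \<star>\<^bsub>W\<^esub> \<sigma>) v h = v \<star>\<^bsub>W\<^esub> h"
proof -
  have inner: "(\<Oplus>\<^bsub>A\<^esub>\<sigma>\<in>Gal. mult_map L (y i) \<otimes>\<^bsub>A\<^esub> \<sigma>) \<in> carrier A" if "i < n" for i
    using that by (auto intro!: A.finsum_closed)
  have orbit: "orbit_sum (of_rmodule L W) (\<lambda>\<sigma> v. v \<star>\<^bsub>W\<^esub> \<sigma>) (v \<star>\<^bsub>W\<^esub> mult_map L (y i))
      = v \<star>\<^bsub>W\<^esub> (\<Oplus>\<^bsub>A\<^esub>\<sigma>\<in>Gal. mult_map L (y i) \<otimes>\<^bsub>A\<^esub> \<sigma>)" if "i < n" for i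
    using that assms finite_galois_group
    by (simp add: orbit_sum_def finsum_of_rmodule ract_finsum W.ract_mult W.ract_closed Pi_iff
        cong: W.V.finsum_cong)
  have "end_act (of_rmodule L W) (\<lambda>\<sigma> v. v \<star>\<^bsub>W\<^esub> \<sigma>) v h
      = (\<Oplus>\<^bsub>W\<^esub>i\<in>{..<n}. v \<star>\<^bsub>W\<^esub> ((\<Oplus>\<^bsub>A\<^esub>\<sigma>\<in>Gal. mult_map L (y i) \<otimes>\<^bsub>A\<^esub> \<sigma>) \<otimes>\<^bsub>A\<^esub> mult_map L (h (x i))))"
    using assms inner
    by (simp add: end_act_def finsum_of_rmodule orbit W.ract_mult W.ract_closed Pi_iff
        cong: W.V.finsum_cong)
  also have "\<dots> = v \<star>\<^bsub>W\<^esub> (\<Oplus>\<^bsub>A\<^esub>i\<in>{..<n}. (\<Oplus>\<^bsub>A\<^esub>\<sigma>\<in>Gal. mult_map L (y i) \<otimes>\<^bsub>A\<^esub> \<sigma>) \<otimes>\<^bsub>A\<^esub> mult_map L (h (x i)))"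
    using assms inner by (intro ract_finsum[symmetric]) auto
  finally show ?thesis
    using assms by (simp add: End_expansion)
qed

end

end


section \<open>The two representation categories\<close>

lemma Rep_Gamma_concrete:
  "Rep_Gamma L K P S = concrete_cat {M. is_grep L K P S M} (grep_hom L K P) (\<lambda>M. carrier (gspace M))"
  by (simp add: Rep_Gamma_def concrete_cat_def)

lemma Rep_alg_concrete:
  "Rep_alg K \<iota> P A T
    = concrete_cat {M. is_arep K \<iota> P A T M} (arep_hom P A) (\<lambda>M. carrier (aspace M))"
  by (simp add: Rep_alg_def concrete_cat_def)

lemma is_grepD:
  assumes "is_grep L K P S M"
  shows "galois_space L K (gspace M) (gact M)" "module L (gspace M)"
    "abelian_group (gspace M)"
    and "p \<in> carrier P \<Longrightarrow> submodule (gsub M p) L (gspace M)"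
    and "p \<in> carrier P \<Longrightarrow> subgroup (gsub M p) (add_monoid (gspace M))"
    and "p \<in> carrier P \<Longrightarrow> gsub M p \<subseteq> carrier (gspace M)"
proof -
  show space: "galois_space L K (gspace M) (gact M)"
    and sub: "p \<in> carrier P \<Longrightarrow> submodule (gsub M p) L (gspace M)" for p
    using assms by (auto simp: is_grep_def)
  then show "module L (gspace M)"
    by (simp add: galois_space_def)
  then show "abelian_group (gspace M)"
    by (simp add: module_def)
  show subgroup: "p \<in> carrier P \<Longrightarrow> subgroup (gsub M p) (add_monoid (gspace M))" for p
    using sub by (simp add: submodule_def)
  then show "p \<in> carrier P \<Longrightarrow> gsub M p \<subseteq> carrier (gspace M)" for p
    using subgroup.subset by fastforce
qed

lemma is_arepD:
  assumes "is_arep K \<iota> P A T M"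
  shows "right_module A (aspace M)" "abelian_group (aspace M)"
    and "p \<in> carrier P \<Longrightarrow> subgroup (asub M p) (add_monoid (aspace M))"
    and "p \<in> carrier P \<Longrightarrow> asub M p \<subseteq> carrier (aspace M)"
proof -
  show "right_module A (aspace M)"
    and subgroup: "p \<in> carrier P \<Longrightarrow> subgroup (asub M p) (add_monoid (aspace M))" for p
    using assms by (auto simp: is_arep_def)
  then show "abelian_group (aspace M)"
    by (simp add: right_module_def)
  show "p \<in> carrier P \<Longrightarrow> asub M p \<subseteq> carrier (aspace M)" for p
    using subgroup subgroup.subset by fastforce
qed

lemma grep_hom_subset_PiE: "grep_hom L K P M N \<subseteq> carrier (gspace M) \<rightarrow>\<^sub>E carrier (gspace N)"
  unfolding grep_hom_def by (rule Collect_restrict)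

lemma arep_hom_subset_PiE: "arep_hom P A M N \<subseteq> carrier (aspace M) \<rightarrow>\<^sub>E carrier (aspace N)"
  unfolding arep_hom_def by (rule Collect_restrict)

lemma category_Rep_Gamma: "category (Rep_Gamma L K P S)"
  unfolding Rep_Gamma_concrete
proof (rule category_concrete_cat)
  fix M N Q f g
  assume M: "M \<in> {M. is_grep L K P S M}"
  interpret module L "gspace M"
    using is_grepD(2) M by blast
  interpret galois_space L K "gspace M" "gact M"
    using is_grepD(1) M by blast
  have sub: "\<And>p. p \<in> carrier P \<Longrightarrow> gsub M p \<subseteq> carrier (gspace M)"
    using is_grepD(6)[of L K P S M] M by simp
  show "(\<lambda>v \<in> carrier (gspace M). v) \<in> grep_hom L K P M M"
    using sub by (auto simp: grep_hom_def act_closed)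
  assume f: "f \<in> grep_hom L K P M N" and g: "g \<in> grep_hom L K P N Q"
  have "f v \<in> carrier (gspace N)" if "v \<in> carrier (gspace M)" for v
    using f that by (auto simp: grep_hom_def)
  then show "compose (carrier (gspace M)) g f \<in> grep_hom L K P M Q"
    using f g sub by (auto simp: grep_hom_def compose_eq act_closed PiE_def subset_eq)
qed (rule grep_hom_subset_PiE)

lemma category_Rep_alg: "category (Rep_alg K \<iota> P A T)"
  unfolding Rep_alg_concrete
proof (rule category_concrete_cat)
  fix M N Q f g
  assume M: "M \<in> {M. is_arep K \<iota> P A T M}"
  interpret right_module A "aspace M"
    using is_arepD(1) M by blast
  have sub: "\<And>p. p \<in> carrier P \<Longrightarrow> asub M p \<subseteq> carrier (aspace M)"
    using is_arepD(4)[of K \<iota> P A T M] M by simp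
  show "(\<lambda>v \<in> carrier (aspace M). v) \<in> arep_hom P A M M"
    using sub by (auto simp: arep_hom_def ract_closed)
  assume f: "f \<in> arep_hom P A M N" and g: "g \<in> arep_hom P A N Q"
  have "f v \<in> carrier (aspace N)" if "v \<in> carrier (aspace M)" for v
    using f that by (auto simp: arep_hom_def)
  then show "compose (carrier (aspace M)) g f \<in> arep_hom P A M Q"
    using f g sub by (auto simp: arep_hom_def compose_eq ract_closed PiE_def subset_eq)
qed (rule arep_hom_subset_PiE)

text \<open>Meant for an object and its image after a passage to the other category and back, where
  the operations are recovered only on the carrier.\<close>

lemma grep_id_hom:
  assumes "is_grep L K P S M"
    and "carrier (gspace N) = carrier (gspace M)" "add (gspace N) = add (gspace M)"
    and "\<And>a v. \<lbrakk>a \<in> carrier L; v \<in> carrier (gspace M)\<rbrakk> \<Longrightarrow> a \<odot>\<^bsub>gspace N\<^esub> v = a \<odot>\<^bsub>gspace M\<^esub> v"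
    and "\<And>\<sigma> v. \<lbrakk>\<sigma> \<in> carrier (galois_group L K); v \<in> carrier (gspace M)\<rbrakk> \<Longrightarrow> gact N \<sigma> v = gact M \<sigma> v"
    and "gsub N = gsub M"
  shows "(\<lambda>v \<in> carrier (gspace M). v) \<in> grep_hom L K P M N \<inter> grep_hom L K P N M"
proof -
  interpret module L "gspace M"
    using is_grepD(2) assms(1) by blast
  interpret galois_space L K "gspace M" "gact M"
    using is_grepD(1) assms(1) by blast
  have "\<And>p. p \<in> carrier P \<Longrightarrow> gsub M p \<subseteq> carrier (gspace M)"
    by (rule is_grepD(6)[OF assms(1)])
  then show ?thesis
    using assms by (auto simp: grep_hom_def act_closed)
qed

lemma arep_id_hom:
  assumes "is_arep K \<iota> P A T M"
    and "carrier (aspace N) = carrier (aspace M)" "add (aspace N) = add (aspace M)"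
    and "\<And>h v. \<lbrakk>h \<in> carrier A; v \<in> carrier (aspace M)\<rbrakk> \<Longrightarrow> v \<star>\<^bsub>aspace N\<^esub> h = v \<star>\<^bsub>aspace M\<^esub> h"
    and "asub N = asub M"
  shows "(\<lambda>v \<in> carrier (aspace M). v) \<in> arep_hom P A M N \<inter> arep_hom P A N M"
proof -
  interpret right_module A "aspace M"
    using is_arepD(1) assms(1) by blast
  have "\<And>p. p \<in> carrier P \<Longrightarrow> asub M p \<subseteq> carrier (aspace M)"
    by (rule is_arepD(4)[OF assms(1)])
  then show ?thesis
    using assms by (auto simp: arep_hom_def ract_closed)
qed

definition to_grep :: "('a, 'b) ring_scheme \<Rightarrow> ('a \<Rightarrow> 'a, 'v, 'p) arep \<Rightarrow> ('a, 'v, 'p) grep" where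
  "to_grep L N = \<lparr>gspace = of_rmodule L (aspace N), gact = \<lambda>\<sigma> v. v \<star>\<^bsub>aspace N\<^esub> \<sigma>, gsub = asub N\<rparr>"

section \<open>Subspaces indexed by the equipped poset\<close>

locale equipped_galois_extension = galois_coordinates L K n x y +
  E: generalized_equipped_poset P "galois_group L K" S
  for L :: "('a, 'b) ring_scheme" (structure) and K n x y
    and P :: "('p, 'q) gorder_scheme" and S
begin

definition to_arep :: "('a, 'v, 'p) grep \<Rightarrow> ('a \<Rightarrow> 'a, 'v, 'p) arep" where
  "to_arep M = \<lparr>aspace = to_rmodule (gspace M) (gact M), asub = gsub M\<rparr>"

lemma finite_S: "\<lbrakk>p \<in> carrier P; q \<in> carrier P; p \<sqsubseteq>\<^bsub>P\<^esub> q\<rbrakk> \<Longrightarrow> finite (S p q)"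
  using E.S_subset finite_galois_group finite_subset by blast

lemma S_Gal: "\<lbrakk>p \<in> carrier P; q \<in> carrier P; p \<sqsubseteq>\<^bsub>P\<^esub> q; \<sigma> \<in> S p q\<rbrakk> \<Longrightarrow> \<sigma> \<in> Gal"
  using E.S_subset by blast

text \<open>Each \<open>S p p\<close> is a non-empty subsemigroup of a finite group, hence contains the identity.\<close>

lemma one_in_S:
  assumes p: "p \<in> carrier P"
  shows "\<one>\<^bsub>galois_group L K\<^esub> \<in> S p p"
proof -
  obtain \<sigma> where \<sigma>: "\<sigma> \<in> S p p"
    using E.S_nonempty p E.P.refl by blast
  then have Gal: "\<sigma> \<in> Gal"
    using S_Gal p E.P.refl by blast
  \<comment> \<open>Exponents start at one, because the zeroth power is the identity, whose
    membership is the claim. The order of \<sigma> is at least one, hence of the form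
    \<open>Suc k\<close>.\<close>
  have pow: "\<sigma> [^]\<^bsub>galois_group L K\<^esub> Suc k \<in> S p p" for k
  proof (induction k)
    case 0
    then show ?case using \<sigma> Gal by simp
  next
    case (Suc k)
    then have "\<sigma> [^]\<^bsub>galois_group L K\<^esub> Suc k \<otimes>\<^bsub>galois_group L K\<^esub> \<sigma>
        \<in> S p p <#>\<^bsub>galois_group L K\<^esub> S p p"
      using \<sigma> unfolding set_mult_def by blast
    then show ?case
      using E.S_mult p E.P.refl by auto
  qed
  have "G.ord \<sigma> \<ge> 1"
    using G.ord_ge_1 finite_galois_group Gal by blast
  then show ?thesis
    using pow[of "G.ord \<sigma> - 1"] G.pow_ord_eq_1[OF Gal] by simp
qed

text \<open>The span is defined by the composite \<mu>_a \<circ> \<sigma>, which in the reversed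
  product has \<sigma> on the left. In this form it can act on vectors factor by factor.\<close>

lemma L_span_iff:
  "t \<in> L_span L K T \<longleftrightarrow>
    (\<exists>a \<in> T \<rightarrow> carrier L. t = (\<Oplus>\<^bsub>A\<^esub>\<sigma>\<in>T. \<sigma> \<otimes>\<^bsub>A\<^esub> mult_map L (a \<sigma>)))"
  by (auto simp: L_span_def End_sel)

text \<open>Coefficients vanishing off \<open>\<sigma>\<close> suffice, as \<mu>_0 is the zero of
  \<open>A\<close>. Such products turn the condition on a whole span into conditions on single
  automorphisms and scalars.\<close>

lemma mult_map_comp_in_L_span:
  assumes "finite T" "T \<subseteq> Gal" "\<sigma> \<in> T" "a \<in> carrier L"
  shows "\<sigma> \<otimes>\<^bsub>A\<^esub> mult_map L a \<in> L_span L K T"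
  unfolding L_span_iff
proof
  let ?a = "\<lambda>\<tau>. if \<tau> = \<sigma> then a else \<zero>"
  show "?a \<in> T \<rightarrow> carrier L"
    using assms by auto
  have T: "\<And>\<tau>. \<tau> \<in> T \<Longrightarrow> \<tau> \<in> carrier A"
    using assms by auto
  have "(\<Oplus>\<^bsub>A\<^esub>\<tau>\<in>T. \<tau> \<otimes>\<^bsub>A\<^esub> mult_map L (?a \<tau>))
      = (\<Oplus>\<^bsub>A\<^esub>\<tau>\<in>T. if \<tau> = \<sigma> then \<sigma> \<otimes>\<^bsub>A\<^esub> mult_map L a else \<zero>\<^bsub>A\<^esub>)"
  proof (intro A.finsum_cong' refl)
    have "mult_map L \<zero> = \<zero>\<^bsub>A\<^esub>"
      by (rule End_eqI) (simp_all add: End_zero_apply)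
    then show "\<tau> \<otimes>\<^bsub>A\<^esub> mult_map L (?a \<tau>)
        = (if \<tau> = \<sigma> then \<sigma> \<otimes>\<^bsub>A\<^esub> mult_map L a else \<zero>\<^bsub>A\<^esub>)" if "\<tau> \<in> T" for \<tau>
      using T[OF that] by simp
  qed (use assms T in auto)
  also have "\<dots> = \<sigma> \<otimes>\<^bsub>A\<^esub> mult_map L a"
    using assms T by (intro A.finsum_delta) auto
  finally show "\<sigma> \<otimes>\<^bsub>A\<^esub> mult_map L a = (\<Oplus>\<^bsub>A\<^esub>\<tau>\<in>T. \<tau> \<otimes>\<^bsub>A\<^esub> mult_map L (?a \<tau>))"
    by simp
qed

text \<open>The condition in \<open>is_grep\<close> concerns sums over all of \<open>S p q\<close>.
  Choosing the zero vector, which lies in \<open>gsub M p\<close>, at every other index isolates one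
  summand.\<close>

lemma gact_gsub:
  assumes M: "is_grep L K P S M" and pq: "p \<in> carrier P" "q \<in> carrier P" "p \<sqsubseteq>\<^bsub>P\<^esub> q"
    and \<sigma>: "\<sigma> \<in> S p q" and v: "v \<in> gsub M p"
  shows "gact M \<sigma> v \<in> gsub M q"
proof -
  interpret V: galois_space L K "gspace M" "gact M"
    using is_grepD(1) M by blast
  let ?v = "\<lambda>\<tau>. if \<tau> = \<sigma> then v else \<zero>\<^bsub>gspace M\<^esub>"
  have v': "v \<in> carrier (gspace M)"
    using v is_grepD(6)[OF M pq(1)] by auto
  have zero: "\<zero>\<^bsub>gspace M\<^esub> \<in> gsub M p"
    using subgroup.one_closed[OF is_grepD(5)[OF M pq(1)]] by simp
  have "gact M \<tau> \<zero>\<^bsub>gspace M\<^esub> = \<zero>\<^bsub>gspace M\<^esub>" if "\<tau> \<in> S p q" for \<tau>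
    using S_Gal[OF pq that]
    by (intro additive_zero[OF V.M.abelian_group_axioms V.M.abelian_group_axioms])
      (auto simp: V.act_closed V.act_add)
  then have "(\<Oplus>\<^bsub>gspace M\<^esub>\<tau>\<in>S p q. gact M \<tau> (?v \<tau>))
      = (\<Oplus>\<^bsub>gspace M\<^esub>\<tau>\<in>S p q. if \<tau> = \<sigma> then gact M \<sigma> v else \<zero>\<^bsub>gspace M\<^esub>)"
    using v' S_Gal[OF pq] by (intro V.M.finsum_cong') (auto simp: V.act_closed)
  also have "\<dots> = gact M \<sigma> v"
    using v' \<sigma> S_Gal[OF pq] finite_S[OF pq] by (intro V.M.finsum_delta) (auto simp: V.act_closed)
  finally have "gact M \<sigma> v = (\<Oplus>\<^bsub>gspace M\<^esub>\<tau>\<in>S p q. gact M \<tau> (?v \<tau>))" ..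
  moreover have "(\<Oplus>\<^bsub>gspace M\<^esub>\<tau>\<in>S p q. gact M \<tau> (?v \<tau>)) \<in> gsub M q"
  proof (rule subsetD)
    show "{\<Oplus>\<^bsub>gspace M\<^esub>\<tau>\<in>S p q. gact M \<tau> (w \<tau>) |w. w \<in> S p q \<rightarrow> gsub M p} \<subseteq> gsub M q"
      using M pq by (simp only: is_grep_def)
    have "?v \<in> S p q \<rightarrow> gsub M p"
      using v zero by auto
    then show "(\<Oplus>\<^bsub>gspace M\<^esub>\<tau>\<in>S p q. gact M \<tau> (?v \<tau>))
        \<in> {\<Oplus>\<^bsub>gspace M\<^esub>\<tau>\<in>S p q. gact M \<tau> (w \<tau>) |w. w \<in> S p q \<rightarrow> gsub M p}"
      by (intro CollectI exI[of _ ?v] conjI refl)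
  qed
  ultimately show ?thesis
    by simp
qed

text \<open>An element \<Sum> \<mu>_{a_\<sigma>} \<sigma> of the span sends v to \<Sum> a_\<sigma>
  s_\<sigma>(v). Each summand lies in the target because that is stable under scalars from
  \<open>L\<close>, not only from \<open>K\<close>.\<close>

lemma is_arep_to_arep:
  assumes M: "is_grep L K P S M"
  shows "is_arep K (mult_map L) P A (\<lambda>p q. L_span L K (S p q)) (to_arep M)"
proof -
  interpret V: galois_space L K "gspace M" "gact M"
    using is_grepD(1) M by blast
  note in_V = is_grepD(6)[OF M, THEN subsetD]
  note act = end_act_mult_map_comp[OF is_grepD(1)[OF M]] end_act_Gal[OF is_grepD(1)[OF M]]
    end_act_mult_map[OF is_grepD(1)[OF M]] end_act_one[OF is_grepD(1)[OF M]]
    end_act_finsum[OF is_grepD(1)[OF M]]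
  have "end_act (gspace M) (gact M) v t \<in> gsub M q"
    if pq: "p \<in> carrier P" "q \<in> carrier P" "p \<sqsubseteq>\<^bsub>P\<^esub> q"
      and v: "v \<in> gsub M p" and t: "t \<in> L_span L K (S p q)" for p q v t
  proof -
    obtain a where a: "a \<in> S p q \<rightarrow> carrier L"
      and t: "t = (\<Oplus>\<^bsub>A\<^esub>\<sigma>\<in>S p q. \<sigma> \<otimes>\<^bsub>A\<^esub> mult_map L (a \<sigma>))"
      using t L_span_iff by blast
    have in_A: "\<sigma> \<otimes>\<^bsub>A\<^esub> mult_map L (a \<sigma>) \<in> carrier A" if "\<sigma> \<in> S p q" for \<sigma>
      using a that S_Gal[OF pq that] by (simp add: Pi_iff)
    have "end_act (gspace M) (gact M) v t
        = (\<Oplus>\<^bsub>gspace M\<^esub>\<sigma>\<in>S p q. end_act (gspace M) (gact M) v (\<sigma> \<otimes>\<^bsub>A\<^esub> mult_map L (a \<sigma>)))"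
      unfolding t using in_V[OF pq(1) v] finite_S[OF pq] in_A by (intro act(5)) auto
    also have "\<dots> \<in> gsub M q"
    proof (rule subgroup_finsum_closed[OF is_grepD(3,5)[OF M]])
      fix \<sigma> assume \<sigma>: "\<sigma> \<in> S p q"
      then have "end_act (gspace M) (gact M) v (\<sigma> \<otimes>\<^bsub>A\<^esub> mult_map L (a \<sigma>)) = a \<sigma> \<odot>\<^bsub>gspace M\<^esub> gact M \<sigma> v"
        using a S_Gal[OF pq] in_V[OF pq(1) v] by (auto simp: act(1,2) Pi_iff)
      also have "\<dots> \<in> gsub M q"
        using gact_gsub[OF M pq \<sigma> v] a \<sigma> submodule.smult_closed[OF is_grepD(4)[OF M pq(2)]] by auto
      finally show "end_act (gspace M) (gact M) v (\<sigma> \<otimes>\<^bsub>A\<^esub> mult_map L (a \<sigma>)) \<in> gsub M q" .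
    qed (use pq finite_S in auto)
    finally show ?thesis .
  qed
  moreover have "subgroup (gsub M p) (add_monoid (to_rmodule (gspace M) (gact M)))"
    if "p \<in> carrier P" for p
    using is_grepD(5)[OF M that] by (rule subgroup_add_cong) simp_all
  moreover have "end_act (gspace M) (gact M) v (mult_map L k) \<in> gsub M p"
    if "p \<in> carrier P" "k \<in> K" "v \<in> gsub M p" for p k v
    using that in_V K_subset submodule.smult_closed[OF is_grepD(4)[OF M]] by (auto simp: act(3))
  moreover have "end_act (gspace M) (gact M) v \<one>\<^bsub>A\<^esub> = v" if "p \<in> carrier P" "v \<in> gsub M p" for p v
    using that in_V act(4) by blast
  ultimately show ?thesis
    using right_module_to_rmodule[OF is_grepD(1)[OF M]] by (simp add: is_arep_def to_arep_def)
qed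

text \<open>Both closure conditions come from the products in \<open>span\<close>: coefficient 1
  leaves a single automorphism of \<open>S p q\<close>, and the identity of \<open>S p p\<close>,
  which is also the unit of \<open>A\<close>, leaves a single scalar.\<close>

lemma is_grep_to_grep:
  assumes N: "is_arep K (mult_map L) P A (\<lambda>p q. L_span L K (S p q)) N"
  shows "is_grep L K P S (to_grep L N)"
proof -
  have span: "v \<star>\<^bsub>aspace N\<^esub> (\<sigma> \<otimes>\<^bsub>A\<^esub> mult_map L a) \<in> asub N q"
    if pq: "p \<in> carrier P" "q \<in> carrier P" "p \<sqsubseteq>\<^bsub>P\<^esub> q"
      and "v \<in> asub N p" "\<sigma> \<in> S p q" "a \<in> carrier L" for p q v \<sigma> a
  proof -
    have "\<forall>v \<in> asub N p. \<forall>t \<in> L_span L K (S p q). v \<star>\<^bsub>aspace N\<^esub> t \<in> asub N q"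
      using N pq by (simp add: is_arep_def)
    then show ?thesis
      using that mult_map_comp_in_L_span[OF finite_S[OF pq] E.S_subset[OF pq]] by simp
  qed
  have one_L: "mult_map L \<one> = \<one>\<^bsub>A\<^esub>"
    by (rule End_eqI) (simp_all add: End_one_apply)
  have one_Gal_End: "\<one>\<^bsub>galois_group L K\<^esub> = \<one>\<^bsub>A\<^esub>"
    by (simp add: one_Gal End_sel)
  have "submodule (asub N p) L (of_rmodule L (aspace N))" if p: "p \<in> carrier P" for p
  proof (intro submodule.intro submodule_axioms.intro)
    show "subgroup (asub N p) (add_monoid (of_rmodule L (aspace N)))"
      using is_arepD(3)[OF N p] by (rule subgroup_add_cong) simp_all
    show "a \<odot>\<^bsub>of_rmodule L (aspace N)\<^esub> v \<in> asub N p" if "a \<in> carrier L" "v \<in> asub N p" for a v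
      using span[OF p p _ that(2) one_in_S[OF p] that(1)] p E.P.refl that
      by (simp add: one_Gal_End)
  qed
  moreover have "(\<Oplus>\<^bsub>aspace N\<^esub>\<sigma>\<in>S p q. v \<sigma> \<star>\<^bsub>aspace N\<^esub> \<sigma>) \<in> asub N q"
    if pq: "p \<in> carrier P" "q \<in> carrier P" "p \<sqsubseteq>\<^bsub>P\<^esub> q" and v: "v \<in> S p q \<rightarrow> asub N p" for p q v
  proof (rule subgroup_finsum_closed[OF is_arepD(2,3)[OF N]])
    show "v \<sigma> \<star>\<^bsub>aspace N\<^esub> \<sigma> \<in> asub N q" if "\<sigma> \<in> S p q" for \<sigma>
      using span[OF pq _ that, of "v \<sigma>" \<one>] v that S_Gal[OF pq that] by (auto simp: one_L)
  qed (use pq finite_S in auto)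
  ultimately show ?thesis
    using galois_space_of_rmodule[OF is_arepD(1)[OF N]]
    by (auto simp: is_grep_def to_grep_def finsum_of_rmodule)
qed

section \<open>Morphisms and the equivalence\<close>

text \<open>The formula for \<open>end_act\<close> uses only finite sums, scalars and the
  s_\<sigma>, all of which \<psi> respects.\<close>

lemma grep_hom_subset_arep_hom:
  assumes M: "is_grep L K P S M" and N: "is_grep L K P S N"
  shows "grep_hom L K P M N \<subseteq> arep_hom P A (to_arep M) (to_arep N)"
proof
  fix \<psi> assume \<psi>: "\<psi> \<in> grep_hom L K P M N"
  interpret V: galois_space L K "gspace M" "gact M"
    using is_grepD(1) M by blast
  note orbit_closed = orbit_sum_closed[OF is_grepD(1)[OF M]]
  have closed: "\<psi> \<in> carrier (gspace M) \<rightarrow> carrier (gspace N)"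
    and add: "\<And>v w. \<lbrakk>v \<in> carrier (gspace M); w \<in> carrier (gspace M)\<rbrakk>
      \<Longrightarrow> \<psi> (v \<oplus>\<^bsub>gspace M\<^esub> w) = \<psi> v \<oplus>\<^bsub>gspace N\<^esub> \<psi> w"
    and smult: "\<And>a v. \<lbrakk>a \<in> carrier L; v \<in> carrier (gspace M)\<rbrakk>
      \<Longrightarrow> \<psi> (a \<odot>\<^bsub>gspace M\<^esub> v) = a \<odot>\<^bsub>gspace N\<^esub> \<psi> v"
    and act: "\<And>\<sigma> v. \<lbrakk>\<sigma> \<in> Gal; v \<in> carrier (gspace M)\<rbrakk> \<Longrightarrow> \<psi> (gact M \<sigma> v) = gact N \<sigma> (\<psi> v)"
    using \<psi> by (auto simp: grep_hom_def)
  interpret V': galois_space L K "gspace N" "gact N"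
    using is_grepD(1) N by blast
  note closed' = funcset_mem[OF closed]
  note sum = additive_finsum[where f = \<psi>, OF is_grepD(3)[OF M] is_grepD(3)[OF N] closed add]
  have orbit: "\<psi> (orbit_sum (gspace M) (gact M) v) = orbit_sum (gspace N) (gact N) (\<psi> v)"
    if "v \<in> carrier (gspace M)" for v
    unfolding orbit_sum_def using that finite_galois_group
    by (subst sum) (auto simp: V.act_closed V'.act_closed act closed' intro!: V'.M.finsum_cong')
  have "\<psi> (end_act (gspace M) (gact M) v h) = end_act (gspace N) (gact N) (\<psi> v) h"
    if "v \<in> carrier (gspace M)" "h \<in> carrier A" for v h
    unfolding end_act_def using that
    by (subst sum) (auto simp: orbit_closed orbit_sum_closed[OF is_grepD(1)[OF N]] closed' smult orbit
        intro!: V'.M.finsum_cong')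
  then show "\<psi> \<in> arep_hom P A (to_arep M) (to_arep N)"
    using \<psi> by (auto simp: arep_hom_def grep_hom_def to_arep_def)
qed

text \<open>Scalars and automorphisms act through elements of \<open>A\<close>, so linearity over
  \<open>A\<close> already covers them.\<close>

lemma arep_hom_subset_grep_hom: "arep_hom P A M N \<subseteq> grep_hom L K P (to_grep L M) (to_grep L N)"
  by (auto simp: arep_hom_def grep_hom_def to_grep_def)

theorem equivalent_Rep:
  "equivalent_categories
    (Rep_Gamma L K P S :: (('a, 'v, 'p) grep, 'v \<Rightarrow> 'v) cat)
    (Rep_alg K (mult_map L) P A (\<lambda>p q. L_span L K (S p q)) :: (('a \<Rightarrow> 'a, 'v, 'p) arep, 'v \<Rightarrow> 'v) cat)"
  unfolding Rep_Gamma_concrete Rep_alg_concrete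
proof (rule equivalent_concrete_cats[where F = to_arep and G = "to_grep L"])
  fix M N :: "('a, 'v, 'p) grep"
  assume "M \<in> {M. is_grep L K P S M}"
  then have M: "is_grep L K P S M"
    by simp
  show "to_arep M \<in> {M. is_arep K (mult_map L) P A (\<lambda>p q. L_span L K (S p q)) M}"
    using is_arep_to_arep[OF M] by simp
  show "carrier (aspace (to_arep M)) = carrier (gspace M)"
    by (simp add: to_arep_def)
  \<comment> \<open>The round trip keeps the scalars and the group action on the carrier, by
    \<open>end_act_mult_map\<close> and \<open>end_act_Gal\<close>; outside it
    \<open>end_act\<close> may take other values.\<close>
  show "(\<lambda>v \<in> carrier (gspace M). v)
      \<in> grep_hom L K P M (to_grep L (to_arep M)) \<inter> grep_hom L K P (to_grep L (to_arep M)) M"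
    using M
    by (rule grep_id_hom)
      (simp_all add: to_grep_def to_arep_def end_act_mult_map[OF is_grepD(1)[OF M]]
        end_act_Gal[OF is_grepD(1)[OF M]])
  assume "N \<in> {M. is_grep L K P S M}"
  then show "grep_hom L K P M N \<subseteq> arep_hom P A (to_arep M) (to_arep N)"
    using grep_hom_subset_arep_hom M by simp
next
  fix N :: "('a \<Rightarrow> 'a, 'v, 'p) arep"
  assume "N \<in> {M. is_arep K (mult_map L) P A (\<lambda>p q. L_span L K (S p q)) M}"
  then have N: "is_arep K (mult_map L) P A (\<lambda>p q. L_span L K (S p q)) N"
    by simp
  show "to_grep L N \<in> {M. is_grep L K P S M}"
    using is_grep_to_grep[OF N] by simp
  \<comment> \<open>In this direction the action is rebuilt from its restriction, and
    \<open>end_act_of_rmodule\<close> says that nothing was lost.\<close>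
  show "(\<lambda>v \<in> carrier (aspace N). v)
      \<in> arep_hom P A N (to_arep (to_grep L N)) \<inter> arep_hom P A (to_arep (to_grep L N)) N"
    using N
    by (rule arep_id_hom)
      (simp_all add: to_grep_def to_arep_def end_act_of_rmodule[OF is_arepD(1)[OF N]])
  show "carrier (gspace (to_grep L N)) = carrier (aspace N)"
    by (simp add: to_grep_def)
next
  show "category (concrete_cat {M. is_grep L K P S M} (grep_hom L K P) (\<lambda>M. carrier (gspace M)))"
    using category_Rep_Gamma by (simp only: Rep_Gamma_concrete)
  show "category (concrete_cat {M. is_arep K (mult_map L) P A (\<lambda>p q. L_span L K (S p q)) M}
      (arep_hom P A) (\<lambda>M. carrier (aspace M)))"
    using category_Rep_alg by (simp only: Rep_alg_concrete)
  show "grep_hom L K P M N \<subseteq> carrier (gspace M) \<rightarrow>\<^sub>E carrier (gspace N)" for M N :: "('a, 'v, 'p) grep"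
    by (rule grep_hom_subset_PiE)
  show "arep_hom P A M N \<subseteq> carrier (aspace M) \<rightarrow>\<^sub>E carrier (aspace N)"
    "arep_hom P A M N \<subseteq> grep_hom L K P (to_grep L M) (to_grep L N)"
    for M N :: "('a \<Rightarrow> 'a, 'v, 'p) arep"
    by (rule arep_hom_subset_PiE arep_hom_subset_grep_hom)+
qed

end

theorem theorem6:
  fixes L :: "('a, 'b) ring_scheme" and K :: "'a set"
    and P :: "('p, 'q) gorder_scheme" and S :: "'p \<Rightarrow> 'p \<Rightarrow> ('a \<Rightarrow> 'a) set"
  assumes "galois_extension L K"
    and "finite (carrier (galois_group L K))"
    and "generalized_equipped_poset P (galois_group L K) S"
  shows "equivalent_categories
    (Rep_Gamma L K P S :: (('a, 'v, 'p) grep, 'v \<Rightarrow> 'v) cat)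
    (Rep_alg K (mult_map L) P (opposite_ring (End_K L K)) (\<lambda>x y. L_span L K (S x y))
      :: (('a \<Rightarrow> 'a, 'v, 'p) arep, 'v \<Rightarrow> 'v) cat)"
proof -
  interpret galois_extension L K by fact
  interpret E: generalized_equipped_poset P "galois_group L K" S by fact
  interpret finite_galois_extension L K
    by unfold_locales fact
  obtain n :: nat and x y where
    xy: "x \<in> {..<n} \<rightarrow> carrier L" "y \<in> {..<n} \<rightarrow> carrier L"
    and one: "(\<Oplus>\<^bsub>L\<^esub>i\<in>{..<n}. x i \<otimes>\<^bsub>L\<^esub> y i) = \<one>\<^bsub>L\<^esub>"
    and zero: "\<And>\<sigma>. \<sigma> \<in> Gal - {\<one>\<^bsub>galois_group L K\<^esub>}
      \<Longrightarrow> (\<Oplus>\<^bsub>L\<^esub>i\<in>{..<n}. x i \<otimes>\<^bsub>L\<^esub> \<sigma> (y i)) = \<zero>\<^bsub>L\<^esub>"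
    using exists_separating_coordinates[of "Gal - {\<one>\<^bsub>galois_group L K\<^esub>}"] finite_galois_group
    by auto
  \<comment> \<open>The unit of the Galois group is the restricted identity map, so equation
    \<open>one\<close> is the separating condition at the identity.\<close>
  have "(\<Oplus>\<^bsub>L\<^esub>i\<in>{..<n}. x i \<otimes>\<^bsub>L\<^esub> \<one>\<^bsub>galois_group L K\<^esub> (y i)) = (\<Oplus>\<^bsub>L\<^esub>i\<in>{..<n}. x i \<otimes>\<^bsub>L\<^esub> y i)"
    using xy by (intro finsum_cong') (auto simp: one_Gal Pi_iff)
  then interpret equipped_galois_extension L K n x y P S
    using xy one zero by unfold_locales auto
  show ?thesis
    by (rule equivalent_Rep)
qed

end
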